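(* Let $\mathbb{N}=\{1,2,\dots\}$, $\mathcal{X}=\{(i,j)\in\mathbb{N}\times\mathbb{N}: i=j \text{ or } i=j+1\}$, and let $\pi$ be the probability measure on $\mathcal{X}$ with $\pi(i,j)\propto j^{-2}$. There exists a sequence $(a_n)_{n\ge 0}$ with $8<a_n\nearrow\infty$ (non-decreasing and tending to infinity) such that the adaptive random scan Gibbs sampler $(X_n)_{n\ge0}$ for $\pi$ which, at each step $n\ge 1$, uses the selection probabilities $$\alpha_n=\begin{cases}\left(\tfrac12+\tfrac4{a_n},\ \tfrac12-\tfrac4{a_n}\right) & \text{if } X_{n-1}=(i,j) \text{ with } i=j,\\[4pt] \left(\tfrac12-\tfrac4{a_n},\ \tfrac12+\tfrac4{a_n}\right) & \text{if } X_{n-1}=(i,j)\text{ with } i=j+1,\end{cases}$$ is not ergodic. Specifically, when started at $X_0=(1,1)$, it satisfies $\mathbb{P}(X_{n,1}\to\infty)>0$, so that $X_n$ does not converge in distribution to any probability measure on $\mathcal{X}$; in particular $\|\pi_n-\pi\|_{TV}\nrightarrow 0$, where $\pi_n$ is the distribution of $X_n$.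
   Context: Write $X_n=(X_{n,1},X_{n,2})$. Given $X_0,\dots,X_{n-1}$, the adaptive random scan Gibbs sampler produces $X_n$ as follows: compute $\alpha_n=(\alpha_{n,1},\alpha_{n,2})$ by the given rule; choose a coordinate $i\in\{1,2\}$ with probabilities $\alpha_{n,1},\alpha_{n,2}$; replace coordinate $i$ of $X_{n-1}$ by a draw from the conditional distribution under $\pi$ of coordinate $i$ given that the other coordinate equals its current value in $X_{n-1}$; leave the other coordinate unchanged. The sampler is called ergodic if the total variation distance between the law of $X_n$ (started at $X_0=x_0$) and $\pi$ tends to $0$ for $\pi$-almost every starting state $x_0$ (and all initial selection probabilities; here the rule for $\alpha_n$ does not depend on $\alpha_{n-1}$). *)

theory Defs
  imports "HOL-Probability.Probability"
begin

section \<open>Adaptive random scan Gibbs sampler with two coordinates\<close>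

text \<open>Coordinates are numbered 1 and 2. A vector \<open>\<alpha>\<close> of selection probabilities is a pair of
  nonnegative reals with sum 1.\<close>

definition coordinate_pmf :: "real \<times> real \<Rightarrow> nat pmf" where
  "coordinate_pmf \<alpha> = embed_pmf (\<lambda>i. if i = 1 then fst \<alpha> else if i = 2 then snd \<alpha> else 0)"

definition gibbs_update :: "('a \<times> 'b) pmf \<Rightarrow> nat \<Rightarrow> 'a \<times> 'b \<Rightarrow> ('a \<times> 'b) pmf" where
  "gibbs_update p i x =
     (if i = 1 then map_pmf (\<lambda>u. (u, snd x)) (map_pmf fst (cond_pmf p {y. snd y = snd x}))
      else map_pmf (\<lambda>v. (fst x, v)) (map_pmf snd (cond_pmf p {y. fst y = fst x})))"

definition gibbs_step :: "('a \<times> 'b) pmf \<Rightarrow> real \<times> real \<Rightarrow> 'a \<times> 'b \<Rightarrow> ('a \<times> 'b) pmf" where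
  "gibbs_step p \<alpha> x = bind_pmf (coordinate_pmf \<alpha>) (\<lambda>i. gibbs_update p i x)"

text \<open>A selection rule maps the history \<open>[X\<^sub>0, \<dots>, X\<^sub>n\<^sub>-\<^sub>1]\<close> (a list of length \<open>n \<ge> 1\<close>) to the selection
  probabilities used at step \<open>n\<close>. \<open>gibbs_kernel p R x0 n\<close> is the conditional law of \<open>X\<^sub>n\<close>
  given the earlier states; for \<open>n = 0\<close> it is the point mass at the starting state.\<close>

definition gibbs_kernel ::
  "('a \<times> 'b) pmf \<Rightarrow> (('a \<times> 'b) list \<Rightarrow> real \<times> real) \<Rightarrow> 'a \<times> 'b \<Rightarrow> nat \<Rightarrow> (nat \<Rightarrow> 'a \<times> 'b) \<Rightarrow> ('a \<times> 'b) measure"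
where
  "gibbs_kernel p R x0 n \<omega> =
     measure_pmf (if n = 0 then return_pmf x0
                  else gibbs_step p (R (map \<omega> [0..<n])) (\<omega> (n - 1)))"

text \<open>The law of the whole trajectory \<open>(X\<^sub>n)\<close>, on the space of sequences of states, is the measure
  that the Ionescu-Tulcea theorem assigns to these kernels; \<open>X\<^sub>n\<close> is the \<open>n\<close>-th coordinate map.
  The lemmas \<open>gibbs_chain_cylinder_0\<close> and \<open>gibbs_chain_cylinder_Suc\<close> below characterize
  it through its values on finite paths.\<close>

definition gibbs_chain ::
  "('a \<times> 'b) pmf \<Rightarrow> (('a \<times> 'b) list \<Rightarrow> real \<times> real) \<Rightarrow> 'a \<times> 'b \<Rightarrow> (nat \<Rightarrow> 'a \<times> 'b) measure"
where
  "gibbs_chain p R x0 =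
     projective_family.lim UNIV
       (Ionescu_Tulcea.CI (gibbs_kernel p R x0) (\<lambda>_. count_space UNIV)) (\<lambda>_. count_space UNIV)"

definition gibbs_law ::
  "('a \<times> 'b) pmf \<Rightarrow> (('a \<times> 'b) list \<Rightarrow> real \<times> real) \<Rightarrow> 'a \<times> 'b \<Rightarrow> nat \<Rightarrow> ('a \<times> 'b) measure" where
  "gibbs_law p R x0 n = distr (gibbs_chain p R x0) (count_space UNIV) (\<lambda>\<omega>. \<omega> n)"

definition tv_dist :: "'a measure \<Rightarrow> 'a measure \<Rightarrow> real" where
  "tv_dist \<mu> \<nu> = (SUP A\<in>sets \<mu>. \<bar>measure \<mu> A - measure \<nu> A\<bar>)"

text \<open>A rule of the above type does not involve earlier selection probabilities, so there is no
  initial selection probability to quantify over.\<close>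

definition ergodic :: "('a \<times> 'b) pmf \<Rightarrow> (('a \<times> 'b) list \<Rightarrow> real \<times> real) \<Rightarrow> bool" where
  "ergodic p R \<longleftrightarrow>
     (AE x0 in measure_pmf p. (\<lambda>n. tv_dist (gibbs_law p R x0 n) (measure_pmf p)) \<longlonglongrightarrow> 0)"

definition converges_in_distribution ::
  "(nat \<Rightarrow> 'a::topological_space measure) \<Rightarrow> 'a measure \<Rightarrow> bool" where
  "converges_in_distribution \<mu> \<nu> \<longleftrightarrow>
     (\<forall>f :: 'a \<Rightarrow> real. continuous_on UNIV f \<and> bounded (range f) \<longrightarrow>
        (\<lambda>n. \<integral>x. f x \<partial>\<mu> n) \<longlonglongrightarrow> (\<integral>x. f x \<partial>\<nu>))"


subsection \<open>The trajectory law is well defined\<close>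

lemma Ionescu_Tulcea_gibbs_kernel:
  fixes p :: "('a::countable \<times> 'b::countable) pmf"
  shows "Ionescu_Tulcea (gibbs_kernel p R x0) (\<lambda>_. count_space UNIV)"
proof (rule Ionescu_Tulcea.intro)
  fix n :: nat
  have "PiM {0..<n} (\<lambda>_. count_space (UNIV :: ('a \<times> 'b) set)) = count_space (PiE {0..<n} (\<lambda>_. UNIV))"
    by (rule count_space_PiM_finite) auto
  moreover have "gibbs_kernel p R x0 n \<omega> \<in> space (subprob_algebra (count_space UNIV))" for \<omega>
    by (simp add: gibbs_kernel_def space_subprob_algebra prob_space_imp_subprob_space prob_space_measure_pmf)
  ultimately show "gibbs_kernel p R x0 n \<in> measurable (PiM {0..<n} (\<lambda>_. count_space UNIV))
      (subprob_algebra (count_space UNIV))"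
    by simp
qed (simp add: gibbs_kernel_def prob_space_measure_pmf)

lemma
  fixes p :: "('a::countable \<times> 'b::countable) pmf"
  shows prob_space_gibbs_chain: "prob_space (gibbs_chain p R x0)"
    and sets_gibbs_chain: "sets (gibbs_chain p R x0) = sets (PiM UNIV (\<lambda>_. count_space UNIV))"
    and space_gibbs_chain: "space (gibbs_chain p R x0) = UNIV"
    and gibbs_chain_cylinder_0: "emeasure (gibbs_chain p R x0) {\<omega>. \<omega> 0 = h 0} = indicator {x0} (h 0)"
    and gibbs_chain_cylinder_Suc: "n > 0 \<Longrightarrow> emeasure (gibbs_chain p R x0) {\<omega>. \<forall>i\<le>n. \<omega> i = h i} =
      emeasure (gibbs_chain p R x0) {\<omega>. \<forall>i<n. \<omega> i = h i} *
      pmf (gibbs_step p (R (map h [0..<n])) (h (n - 1))) (h n)"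
proof -
  let ?S = "\<lambda>_::nat. count_space (UNIV :: ('a \<times> 'b) set)"
  let ?K = "gibbs_kernel p R x0"
  interpret IT: Ionescu_Tulcea ?K ?S
    by (rule Ionescu_Tulcea_gibbs_kernel)
  have G: "gibbs_chain p R x0 = IT.PF.lim"
    by (simp add: gibbs_chain_def)
  show s: "sets (gibbs_chain p R x0) = sets (PiM UNIV ?S)"
    by (simp add: G)
  show sp: "space (gibbs_chain p R x0) = UNIV"
    using sets_eq_imp_space_eq[OF s] by (simp add: space_PiM)
  have cs: "PiM {0..<n} ?S = count_space (PiE {0..<n} (\<lambda>_. UNIV))" for n
    by (rule count_space_PiM_finite) auto
  have sing: "{restrict h {0..<n}} \<in> sets (PiM {0..<n} ?S)" for n
    by (simp add: cs)
  have lim: "emeasure (gibbs_chain p R x0) {\<omega>. \<forall>i<n. \<omega> i = h i} =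
      emeasure (IT.C 0 n (\<lambda>_. undefined)) {restrict h {0..<n}}" for n
  proof -
    have "{\<omega>. \<forall>i<n. \<omega> i = h i} = IT.PF.emb UNIV {0..<n} {restrict h {0..<n}}"
      by (auto simp: prod_emb_def space_PiM restrict_def fun_eq_iff) (metis)
    then have "emeasure (gibbs_chain p R x0) {\<omega>. \<forall>i<n. \<omega> i = h i} =
        emeasure (IT.CI {0..<n}) {restrict h {0..<n}}"
      using IT.lim[OF _ sing, of n] by (simp add: G)
    also have "\<dots> = emeasure (IT.C 0 n (\<lambda>_. undefined)) (IT.PF.emb {0..<n} {0..<n} {restrict h {0..<n}})"
      by (rule IT.emeasure_CI[OF _ sing]) simp
    also have "IT.PF.emb {0..<n} {0..<n} {restrict h {0..<n}} = {restrict h {0..<n}}"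
      using sets.sets_into_space[OF sing] by (intro prod_emb_id) (simp add: space_PiM)
    finally show ?thesis .
  qed
  have u: "(\<lambda>_. undefined) \<in> space (PiM {0..<0} ?S)"
    by (simp add: space_PiM)
  have step: "emeasure (IT.C 0 (Suc n) (\<lambda>_. undefined)) {restrict h {0..<Suc n}} =
      emeasure (IT.C 0 n (\<lambda>_. undefined)) {restrict h {0..<n}} * emeasure (?K n h) {h n}" for n
  proof -
    have sC: "sets (IT.C 0 n (\<lambda>_. undefined)) = sets (PiM {0..<n} ?S)"
      using IT.sets_C[OF u, of n] by simp
    have spC: "space (IT.C 0 n (\<lambda>_. undefined)) = space (PiM {0..<n} ?S)"
      using IT.space_C[OF u, of n] by simp
    have ne: "space (PiM {0..<n} ?S) \<noteq> {}"
      by (simp add: space_PiM PiE_eq_empty_iff)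
    have "emeasure (IT.C 0 (Suc n) (\<lambda>_. undefined)) {restrict h {0..<Suc n}} =
        (\<integral>\<^sup>+\<omega>. emeasure (IT.eP n \<omega>) {restrict h {0..<Suc n}} \<partial>IT.C 0 n (\<lambda>_. undefined))"
      using ne sing[of "Suc n"] IT.measurable_eP[of n]
      by (simp add: emeasure_bind[of _ _ "PiM {0..<Suc n} ?S"] spC measurable_cong_sets[OF sC refl])
    also have "\<dots> = (\<integral>\<^sup>+\<omega>. emeasure (?K n h) {h n} * indicator {restrict h {0..<n}} \<omega> \<partial>IT.C 0 n (\<lambda>_. undefined))"
    proof (rule nn_integral_cong)
      fix \<omega> assume "\<omega> \<in> space (IT.C 0 n (\<lambda>_. undefined))"
      then have \<omega>: "\<omega> \<in> space (PiM {0..<n} ?S)"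
        by (simp add: spC)
      have v: "(fun_upd \<omega> n) -` {restrict h {0..<Suc n}} =
          (if \<omega> = restrict h {0..<n} then {h n} else {})"
        using \<omega> by (auto simp: space_PiM PiE_def extensional_def restrict_def fun_eq_iff less_Suc_eq split: if_splits)
      have "map (restrict h {0..<n}) [0..<n] = map h [0..<n]"
        by (rule map_cong) auto
      then have "?K n (restrict h {0..<n}) = ?K n h"
        by (simp add: gibbs_kernel_def del: map_eq_conv)
      then show "emeasure (IT.eP n \<omega>) {restrict h {0..<Suc n}} =
          emeasure (?K n h) {h n} * indicator {restrict h {0..<n}} \<omega>"
        using IT.emeasure_eP[OF \<omega> sing[of "Suc n"]] by (simp add: v)
    qed
    also have "\<dots> = emeasure (?K n h) {h n} * emeasure (IT.C 0 n (\<lambda>_. undefined)) {restrict h {0..<n}}"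
      using sing[of n] by (subst nn_integral_cmult_indicator) (simp_all add: sC)
    finally show ?thesis
      by (simp add: mult.commute)
  qed
  have C0: "emeasure (IT.C 0 0 (\<lambda>_. undefined)) {restrict h {0..<0}} = 1"
    using sing[of 0] by (simp add: restrict_def PiM_empty)
  show "prob_space (gibbs_chain p R x0)"
  proof
    have "UNIV = {\<omega> :: nat \<Rightarrow> 'a \<times> 'b. \<forall>i<0. \<omega> i = h i}"
      by simp
    then show "emeasure (gibbs_chain p R x0) (space (gibbs_chain p R x0)) = 1"
      using lim[of 0] C0 by (simp add: sp)
  qed
  show "emeasure (gibbs_chain p R x0) {\<omega>. \<omega> 0 = h 0} = indicator {x0} (h 0)"
    using lim[of "Suc 0"] step[of 0] C0
    by (simp add: gibbs_kernel_def indicator_def del: IT.C.simps)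
  show "emeasure (gibbs_chain p R x0) {\<omega>. \<forall>i\<le>n. \<omega> i = h i} =
      emeasure (gibbs_chain p R x0) {\<omega>. \<forall>i<n. \<omega> i = h i} *
      pmf (gibbs_step p (R (map h [0..<n])) (h (n - 1))) (h n)" if "n > 0"
    using lim[of n] lim[of "Suc n"] step[of n] that
    by (simp add: gibbs_kernel_def less_Suc_eq_le emeasure_pmf_single del: IT.C.simps)
qed


section \<open>The target distribution and the selection rule\<close>

definition state_space :: "(nat \<times> nat) set" where
  "state_space = {(i, j). i \<ge> 1 \<and> j \<ge> 1 \<and> (i = j \<or> i = j + 1)}"

definition weight :: "nat \<times> nat \<Rightarrow> real" where
  "weight = (\<lambda>(i, j). if (i, j) \<in> state_space then 1 / (real j)\<^sup>2 else 0)"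

definition target :: "(nat \<times> nat) pmf" where
  "target = embed_pmf (\<lambda>x. weight x / (\<Sum>\<^sub>\<infinity>y\<in>state_space. weight y))"

text \<open>The last entry of the history is \<open>X\<^sub>n\<^sub>-\<^sub>1\<close>; on \<open>state_space\<close> the \<open>else\<close> branch is the case \<open>i = j + 1\<close>.\<close>

definition diagonal_rule :: "(nat \<Rightarrow> real) \<Rightarrow> (nat \<times> nat) list \<Rightarrow> real \<times> real" where
  "diagonal_rule a h =
     (let n = length h; (i, j) = last h in
      if i = j then (1/2 + 4 / a n, 1/2 - 4 / a n) else (1/2 - 4 / a n, 1/2 + 4 / a n))"

lemma
  shows weight_summable: "weight summable_on state_space"
    and weight_total_pos: "(\<Sum>\<^sub>\<infinity>y\<in>state_space. weight y) > 0"
    and pmf_target: "pmf target x = weight x / (\<Sum>\<^sub>\<infinity>y\<in>state_space. weight y)"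
    and set_pmf_target: "set_pmf target = state_space"
proof -
  let ?D = "(\<lambda>j::nat. (j, j)) ` {1..}" and ?E = "(\<lambda>j::nat. (j + 1, j)) ` {1..}"
  let ?Z = "\<Sum>\<^sub>\<infinity>y\<in>state_space. weight y"
  have nonneg: "weight y \<ge> 0" for y
    by (auto simp: weight_def split: prod.splits)
  have split: "state_space = ?D \<union> ?E" "?D \<inter> ?E = {}"
    by (auto simp: state_space_def)
  have "summable (\<lambda>j. norm (1 / (real j)\<^sup>2))"
    using inverse_power_summable[of 2, where 'a=real] by (simp add: field_simps)
  then have s: "(\<lambda>j. 1 / (real j)\<^sup>2) summable_on {1..}"
    by (metis norm_summable_imp_summable_on summable_on_subset_banach subset_UNIV)
  have "weight summable_on ?D"
    using s by (subst summable_on_reindex) (auto simp: inj_on_def o_def weight_def state_space_def elim!: summable_on_cong[THEN iffD1, rotated])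
  moreover have "weight summable_on ?E"
    using s by (subst summable_on_reindex) (auto simp: inj_on_def o_def weight_def state_space_def elim!: summable_on_cong[THEN iffD1, rotated])
  ultimately show sw: "weight summable_on state_space"
    unfolding split(1) by (intro summable_on_Un_disjoint split(2))
  have "(\<Sum>\<^sub>\<infinity>y\<in>{(1, 1)}. weight y) \<le> ?Z"
    using sw nonneg by (intro infsum_mono_neutral) (auto simp: state_space_def)
  then show Z: "?Z > 0"
    by (simp add: weight_def state_space_def)
  have "(\<integral>\<^sup>+x. ennreal (weight x / ?Z) \<partial>count_space UNIV) =
      (\<integral>\<^sup>+x. ennreal (weight x / ?Z) \<partial>count_space state_space)"
    by (auto simp: nn_integral_count_space_indicator weight_def indicator_def intro!: nn_integral_cong split: prod.splits)
  also have "\<dots> = ennreal (\<Sum>\<^sub>\<infinity>x\<in>state_space. weight x / ?Z)"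
  proof -
    have "(\<lambda>x. norm (weight x / ?Z)) summable_on state_space"
      using summable_on_cmult_left[OF sw, of "1 / ?Z"] nonneg Z by simp
    then have "Infinite_Set_Sum.abs_summable_on (\<lambda>x. weight x / ?Z) state_space"
      using abs_summable_equivalent by blast
    then show ?thesis
      using nonneg Z by (subst nn_integral_conv_infsetsum) (auto simp: infsetsum_infsum)
  qed
  also have "(\<Sum>\<^sub>\<infinity>x\<in>state_space. weight x / ?Z) = 1"
    using infsum_cmult_left[OF sw, of "1 / ?Z"] Z by simp
  finally have one: "(\<integral>\<^sup>+x. ennreal (weight x / ?Z) \<partial>count_space UNIV) = 1"
    by simp
  show pm: "pmf target x = weight x / ?Z" for x
    unfolding target_def using nonneg Z one by (intro pmf_embed_pmf) auto
  show "set_pmf target = state_space"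
    using Z by (force simp: set_pmf_eq pm weight_def state_space_def split: if_splits)
qed

end

theory Submission
  imports Defs "HOL-Real_Asymp.Real_Asymp"
begin

text \<open>The states form a single ladder, ordered by \<open>i + j\<close>. The target pulls the walk downwards with a
  drift of order \<open>1 / (i + j)\<close>, whereas the selection bias pushes it upwards with a drift of order
  \<open>1 / a\<^sub>n\<close>; so above height \<open>a\<^sub>n\<close> the walk drifts upwards by at least \<open>2 / a\<^sub>n\<close>. Start with \<open>N\<close> steps
  upwards. By Chernoff's bound with exponent \<open>1 / a\<^sub>k\<close>, the conditional probability that the walk first
  drops below height \<open>a\<^sub>k\<close> at time \<open>k \<ge> N\<close> is at most \<open>exp (1 - k / a\<^sub>k\<^sup>2)\<close>. For \<open>a\<^sub>n = 9 + ln (n + 1)\<close>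
  this is summable, and the tail sum is less than 1 for large \<open>N\<close>: with positive probability the walk
  stays above \<open>a\<^sub>k\<close> for all \<open>k \<ge> N\<close>. The escaping mass is lost to every limit.\<close>

section \<open>The law of finite histories\<close>

lemma gibbs_update_1:
  assumes "x \<in> set_pmf p"
  shows "gibbs_update p 1 x = cond_pmf p {y. snd y = snd x}"
proof -
  have "set_pmf p \<inter> {y. snd y = snd x} \<noteq> {}"
    using assms by auto
  then have "map_pmf (\<lambda>z. (fst z, snd x)) (cond_pmf p {y. snd y = snd x}) =
      map_pmf (\<lambda>z. z) (cond_pmf p {y. snd y = snd x})"
    by (intro map_pmf_cong) (auto simp: set_cond_pmf prod_eq_iff)
  then show ?thesis
    by (simp add: gibbs_update_def pmf.map_comp o_def)
qed

lemma gibbs_update_2: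
  assumes "x \<in> set_pmf p"
  shows "gibbs_update p 2 x = cond_pmf p {y. fst y = fst x}"
proof -
  have "set_pmf p \<inter> {y. fst y = fst x} \<noteq> {}"
    using assms by auto
  then have "map_pmf (\<lambda>z. (fst x, snd z)) (cond_pmf p {y. fst y = fst x}) =
      map_pmf (\<lambda>z. z) (cond_pmf p {y. fst y = fst x})"
    by (intro map_pmf_cong) (auto simp: set_cond_pmf prod_eq_iff)
  then show ?thesis
    by (simp add: gibbs_update_def pmf.map_comp o_def)
qed

lemma nn_integral_coordinate_pmf:
  assumes "0 \<le> s" "0 \<le> t" "s + t = 1"
  shows "(\<integral>\<^sup>+i. f i \<partial>measure_pmf (coordinate_pmf (s, t))) = ennreal s * f 1 + ennreal t * f 2"
proof -
  let ?w = "\<lambda>i::nat. if i = 1 then s else if i = 2 then t else 0"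
  have "(\<integral>\<^sup>+i. ennreal (?w i) \<partial>count_space UNIV) = (\<Sum>i\<in>{1, 2}. ennreal (?w i))"
    by (intro nn_integral_count_space') auto
  also have "\<dots> = 1"
    using assms by (simp flip: ennreal_plus)
  finally have one: "(\<integral>\<^sup>+i. ennreal (?w i) \<partial>count_space UNIV) = 1" .
  have w: "pmf (coordinate_pmf (s, t)) i = ?w i" for i
    unfolding coordinate_pmf_def fst_conv snd_conv using assms by (subst pmf_embed_pmf[OF _ one]) simp_all
  have "(\<integral>\<^sup>+i. f i \<partial>measure_pmf (coordinate_pmf (s, t))) =
      (\<Sum>i\<in>{1, 2}. f i * pmf (coordinate_pmf (s, t)) i)"
    by (rule nn_integral_measure_pmf_support) (auto simp: set_pmf_eq w split: if_splits)
  then show ?thesis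
    by (simp add: w mult.commute)
qed

lemma nn_integral_gibbs_step:
  assumes "0 \<le> s" "0 \<le> t" "s + t = 1" and "x \<in> set_pmf p"
  shows "(\<integral>\<^sup>+y. f y \<partial>measure_pmf (gibbs_step p (s, t) x)) =
    ennreal s * (\<integral>\<^sup>+y. f y \<partial>measure_pmf (cond_pmf p {y. snd y = snd x})) +
    ennreal t * (\<integral>\<^sup>+y. f y \<partial>measure_pmf (cond_pmf p {y. fst y = fst x}))"
  using assms by (simp add: gibbs_step_def nn_integral_coordinate_pmf gibbs_update_1 gibbs_update_2 del: One_nat_def)

lemma set_gibbs_step:
  assumes "x \<in> set_pmf p"
  shows "set_pmf (gibbs_step p \<alpha> x) \<subseteq> set_pmf p"
proof -
  have "set_pmf (gibbs_update p i x) \<subseteq> set_pmf p" for i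
  proof -
    \<comment> \<open>\<open>gibbs_update\<close> treats every index other than 1 as 2, so two cases
      cover whatever index \<open>coordinate_pmf \<alpha>\<close> returns, for arbitrary
      \<open>\<alpha>\<close>.\<close>
    have "gibbs_update p i x = gibbs_update p (if i = 1 then 1 else 2) x"
      by (simp add: gibbs_update_def)
    moreover have "set_pmf p \<inter> {y. snd y = snd x} \<noteq> {}" "set_pmf p \<inter> {y. fst y = fst x} \<noteq> {}"
      using assms by auto
    ultimately show ?thesis
      by (simp add: gibbs_update_1[OF assms] gibbs_update_2[OF assms] set_cond_pmf del: One_nat_def)
  qed
  then show ?thesis
    by (auto simp: gibbs_step_def)
qed

text \<open>The formula also covers \<open>x = y\<close>, where the conditional law is a point mass.\<close>

lemma nn_integral_cond_pmf_pair:
  fixes f :: "'a \<Rightarrow> real"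
  assumes s: "set_pmf p \<inter> s = {x, y}" and f: "\<And>z. 0 \<le> f z"
  shows "(\<integral>\<^sup>+z. ennreal (f z) \<partial>measure_pmf (cond_pmf p s)) =
    ennreal (f x + (f y - f x) * (pmf p y / (pmf p x + pmf p y)))"
proof -
  have ne: "set_pmf p \<inter> s \<noteq> {}"
    using s by auto
  have pos: "pmf p x > 0" "pmf p y > 0" and xy: "x \<in> s" "y \<in> s"
    using s by (auto simp: pmf_positive_iff)
  have "measure p s = measure p {x, y}"
    using s by (intro measure_pmf.finite_measure_eq_AE) (auto simp: AE_measure_pmf_iff)
  then have m: "measure p s = sum (pmf p) {x, y}"
    by (simp add: measure_measure_pmf_finite)
  have "(\<integral>\<^sup>+z. ennreal (f z) \<partial>measure_pmf (cond_pmf p s)) =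
      (\<Sum>z\<in>{x, y}. ennreal (f z) * pmf (cond_pmf p s) z)"
    using s by (intro nn_integral_measure_pmf_support) (auto simp: set_cond_pmf[OF ne])
  also have "\<dots> = (\<Sum>z\<in>{x, y}. ennreal (f z * (pmf p z / measure p s)))"
    using f xy by (intro sum.cong) (auto simp: pmf_cond[OF ne] simp flip: ennreal_mult)
  also have "\<dots> = ennreal (\<Sum>z\<in>{x, y}. f z * (pmf p z / measure p s))"
    using f by (intro sum_ennreal) auto
  also have "(\<Sum>z\<in>{x, y}. f z * (pmf p z / measure p s)) =
      f x + (f y - f x) * (pmf p y / (pmf p x + pmf p y))"
  proof (cases "x = y")
    case True
    then show ?thesis
      using pos by (simp add: m)
  next
    case False
    define Z where "Z = pmf p x + pmf p y"
    have "pmf p x = Z - pmf p y" "Z > 0"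
      using pos by (auto simp: Z_def)
    then show ?thesis
      using False by (simp add: m flip: Z_def) (simp add: field_simps)
  qed
  finally show ?thesis .
qed

text \<open>The law of the list of the first \<open>n + 1\<close> states. The selection rule reads
  the whole past, so the list, and not its last entry alone, is the state of a Markov process;
  one-step estimates then become iterated integrals.\<close>

primrec gibbs_history ::
  "('a \<times> 'b) pmf \<Rightarrow> (('a \<times> 'b) list \<Rightarrow> real \<times> real) \<Rightarrow> 'a \<times> 'b \<Rightarrow> nat \<Rightarrow> ('a \<times> 'b) list pmf" where
  "gibbs_history p R x0 0 = return_pmf [x0]"
| "gibbs_history p R x0 (Suc n) =
    bind_pmf (gibbs_history p R x0 n) (\<lambda>h. map_pmf (\<lambda>x. h @ [x]) (gibbs_step p (R h) (last h)))"

lemma set_gibbs_history: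
  assumes "x0 \<in> set_pmf p" "h \<in> set_pmf (gibbs_history p R x0 n)"
  shows "length h = Suc n \<and> set h \<subseteq> set_pmf p"
  using assms(2)
proof (induction n arbitrary: h)
  case 0
  then show ?case
    using assms(1) by simp
next
  case (Suc n)
  then obtain g x where g: "g \<in> set_pmf (gibbs_history p R x0 n)"
    and x: "x \<in> set_pmf (gibbs_step p (R g) (last g))" and h: "h = g @ [x]"
    by auto
  have "last g \<in> set g"
    using Suc.IH[OF g] by (intro last_in_set) auto
  then show ?case
    using Suc.IH[OF g] set_gibbs_step[of "last g" p "R g"] x h by auto
qed

text \<open>Only the prefix \<open>h\<close> can be extended to \<open>h @ [x]\<close>, so the
  average over prefixes in the bind collapses to a single term.\<close>

lemma pmf_gibbs_history_append:
  "pmf (gibbs_history p R x0 (Suc n)) (h @ [x]) =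
    pmf (gibbs_history p R x0 n) h * pmf (gibbs_step p (R h) (last h)) x"
proof -
  have "pmf (map_pmf (\<lambda>x. g @ [x]) (gibbs_step p (R g) (last g))) (h @ [x]) =
      pmf (gibbs_step p (R h) (last h)) x * indicator {h} g" for g
  proof (cases "g = h")
    case True
    then show ?thesis
      using pmf_map_inj'[of "\<lambda>x. h @ [x]" "gibbs_step p (R h) (last h)" x] by (simp add: inj_on_def)
  next
    case False
    then show ?thesis
      by (subst pmf_map_outside) auto
  qed
  then show ?thesis
    by (simp add: pmf_bind) (simp add: pmf.rep_eq)
qed

text \<open>Both sides obey the same recursion: each new state multiplies the mass of the path by
  its one-step probability.\<close>

lemma gibbs_chain_path:
  fixes p :: "('a::countable \<times> 'b::countable) pmf"
  shows "emeasure (gibbs_chain p R x0) {\<omega>. \<forall>i\<le>n. \<omega> i = h i} =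
    pmf (gibbs_history p R x0 n) (map h [0..<Suc n])"
proof (induction n)
  case 0
  show ?case
    using gibbs_chain_cylinder_0[of p R x0 h] by (auto simp: indicator_def)
next
  case (Suc n)
  have "last (map h [0..<Suc n]) = h n"
    by simp
  then have "pmf (gibbs_history p R x0 (Suc n)) (map h [0..<Suc n] @ [h (Suc n)]) =
      pmf (gibbs_history p R x0 n) (map h [0..<Suc n]) *
      pmf (gibbs_step p (R (map h [0..<Suc n])) (h n)) (h (Suc n))"
    using pmf_gibbs_history_append[of p R x0 n "map h [0..<Suc n]" "h (Suc n)"] by metis
  moreover have "emeasure (gibbs_chain p R x0) {\<omega>. \<forall>i\<le>Suc n. \<omega> i = h i} =
      emeasure (gibbs_chain p R x0) {\<omega>. \<forall>i\<le>n. \<omega> i = h i} *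
      pmf (gibbs_step p (R (map h [0..<Suc n])) (h n)) (h (Suc n))"
    using gibbs_chain_cylinder_Suc[of "Suc n" p R x0 h] by (simp add: less_Suc_eq_le del: upt_Suc)
  ultimately show ?case
    using Suc.IH by (simp add: ennreal_mult)
qed

section \<open>From the trajectory space to discrete laws of histories\<close>

lemma measurable_gibbs_chain_component [measurable]:
  fixes p :: "('a::countable \<times> 'b::countable) pmf"
  shows "(\<lambda>\<omega>. \<omega> n) \<in> measurable (gibbs_chain p R x0) (count_space UNIV)"
proof -
  have "(\<lambda>\<omega>. \<omega> n) \<in> measurable (PiM UNIV (\<lambda>_::nat. count_space (UNIV :: ('a \<times> 'b) set))) (count_space UNIV)"
    by measurable
  then show ?thesis
    by (subst measurable_cong_sets[OF sets_gibbs_chain refl])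
qed

lemma measurable_gibbs_chain_history [measurable]:
  fixes p :: "('a::countable \<times> 'b::countable) pmf"
  shows "(\<lambda>\<omega>. map \<omega> [0..<n]) \<in> measurable (gibbs_chain p R x0) (count_space UNIV)"
proof -
  have "(\<lambda>\<omega>. map \<omega> [0..<n]) -` {l} \<inter> space (gibbs_chain p R x0) \<in> sets (gibbs_chain p R x0)" for l
  proof -
    have "(\<lambda>\<omega>. map \<omega> [0..<n]) -` {l} \<inter> space (gibbs_chain p R x0) =
        {\<omega> \<in> space (gibbs_chain p R x0). length l = n \<and> (\<forall>i<n. \<omega> i = l ! i)}"
      by (intro set_eqI iffI; clarsimp simp: list_eq_iff_nth_eq)
    also have "\<dots> \<in> sets (gibbs_chain p R x0)"
      by measurable
    finally show ?thesis .
  qed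
  then show ?thesis
    by (subst measurable_count_space_eq2_countable) (simp_all del: map_eq_conv vimage_singleton_eq)
qed

text \<open>Lists over a countable type are countable, so singletons determine both measures; a list
  of the wrong length is null for both.\<close>

lemma distr_gibbs_chain_history:
  fixes p :: "('a::countable \<times> 'b::countable) pmf"
  assumes "x0 \<in> set_pmf p"
  shows "distr (gibbs_chain p R x0) (count_space UNIV) (\<lambda>\<omega>. map \<omega> [0..<Suc n]) =
    measure_pmf (gibbs_history p R x0 n)"
proof (rule measure_eqI_countable)
  fix l :: "('a \<times> 'b) list"
  have v: "emeasure (distr (gibbs_chain p R x0) (count_space UNIV) (\<lambda>\<omega>. map \<omega> [0..<Suc n])) {l} =
      emeasure (gibbs_chain p R x0) {\<omega>. map \<omega> [0..<Suc n] = l}"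
    by (subst emeasure_distr) (auto simp: space_gibbs_chain vimage_def simp del: upt_Suc)
  show "emeasure (distr (gibbs_chain p R x0) (count_space UNIV) (\<lambda>\<omega>. map \<omega> [0..<Suc n])) {l} =
      emeasure (measure_pmf (gibbs_history p R x0 n)) {l}"
  proof (cases "length l = Suc n")
    case True
    then have "{\<omega>. map \<omega> [0..<Suc n] = l} = {\<omega>. \<forall>i\<le>n. \<omega> i = l ! i}"
      by (auto simp: list_eq_iff_nth_eq less_Suc_eq_le simp del: upt_Suc)
    moreover have "map ((!) l) [0..<Suc n] = l"
      using True map_nth[of l] by simp
    ultimately show ?thesis
      using v gibbs_chain_path[of p R x0 n "(!) l"] by (simp add: emeasure_pmf_single del: upt_Suc)
  next
    case False
    then have "{\<omega>. map \<omega> [0..<Suc n] = l} = {}"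
      by auto
    moreover have "l \<notin> set_pmf (gibbs_history p R x0 n)"
      using False set_gibbs_history[OF assms] by blast
    ultimately show ?thesis
      using v by (simp add: emeasure_pmf_single pmf_eq_0_set_pmf del: upt_Suc)
  qed
qed auto

lemma emeasure_gibbs_chain_history:
  fixes p :: "('a::countable \<times> 'b::countable) pmf"
  assumes "x0 \<in> set_pmf p"
  shows "emeasure (gibbs_chain p R x0) {\<omega>. P (map \<omega> [0..<Suc n])} =
    emeasure (measure_pmf (gibbs_history p R x0 n)) {h. P h}"
proof -
  have "emeasure (measure_pmf (gibbs_history p R x0 n)) {h. P h} =
      emeasure (distr (gibbs_chain p R x0) (count_space UNIV) (\<lambda>\<omega>. map \<omega> [0..<Suc n])) {h. P h}"
    by (simp only: distr_gibbs_chain_history[OF assms])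
  also have "\<dots> = emeasure (gibbs_chain p R x0)
      ((\<lambda>\<omega>. map \<omega> [0..<Suc n]) -` {h. P h} \<inter> space (gibbs_chain p R x0))"
    by (rule emeasure_distr) (simp_all del: upt_Suc add: measurable_gibbs_chain_history)
  finally show ?thesis
    by (simp only: space_gibbs_chain vimage_def mem_Collect_eq Int_UNIV_right)
qed

lemma AE_gibbs_chain_in_support:
  fixes p :: "('a::countable \<times> 'b::countable) pmf"
  assumes "x0 \<in> set_pmf p"
  shows "AE \<omega> in gibbs_chain p R x0. \<forall>n. \<omega> n \<in> set_pmf p"
proof (subst AE_all_countable, rule allI)
  fix n
  have "emeasure (gibbs_chain p R x0) {\<omega>. \<omega> n \<notin> set_pmf p} =
      emeasure (gibbs_chain p R x0) {\<omega>. last (map \<omega> [0..<Suc n]) \<notin> set_pmf p}"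
    by simp
  also have "\<dots> = emeasure (measure_pmf (gibbs_history p R x0 n)) {h. last h \<notin> set_pmf p}"
    by (rule emeasure_gibbs_chain_history[OF assms])
  also have "\<dots> = 0"
  proof -
    have "last h \<in> set_pmf p" if "h \<in> set_pmf (gibbs_history p R x0 n)" for h
      using set_gibbs_history[OF assms that] last_in_set[of h] by (metis list.size(3) nat.distinct(1) subsetD)
    then show ?thesis
      by (subst measure_pmf.emeasure_eq_measure) (auto simp: measure_pmf_zero_iff)
  qed
  finally have "emeasure (gibbs_chain p R x0) {\<omega>. \<omega> n \<notin> set_pmf p} = 0" .
  moreover have "{\<omega> \<in> space (gibbs_chain p R x0). \<omega> n \<notin> set_pmf p} \<in> sets (gibbs_chain p R x0)"
    by measurable
  ultimately show "AE \<omega> in gibbs_chain p R x0. \<omega> n \<in> set_pmf p"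
    by (intro AE_I[where N = "{\<omega> \<in> space (gibbs_chain p R x0). \<omega> n \<notin> set_pmf p}"])
      (auto simp: space_gibbs_chain)
qed

lemma emeasure_gibbs_law:
  fixes p :: "('a::countable \<times> 'b::countable) pmf"
  shows "emeasure (gibbs_law p R x0 n) A = emeasure (gibbs_chain p R x0) {\<omega>. \<omega> n \<in> A}"
  unfolding gibbs_law_def by (subst emeasure_distr) (auto simp: space_gibbs_chain vimage_def)


section \<open>Drift of the biased step\<close>

text \<open>The two states of a row have equal weight, so the redraw is a fair coin. The two forms
  are anchored at the two possible current states: the first shows the gain from climbing, the
  second the loss from descending.\<close>

lemma target_row:
  fixes f :: "nat \<times> nat \<Rightarrow> real"
  assumes "j \<ge> 1" and f: "\<And>z. 0 \<le> f z"
  shows "(\<integral>\<^sup>+z. ennreal (f z) \<partial>measure_pmf (cond_pmf target {y. snd y = j})) =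
      ennreal (f (j, j) + (f (j + 1, j) - f (j, j)) / 2)"
    and "(\<integral>\<^sup>+z. ennreal (f z) \<partial>measure_pmf (cond_pmf target {y. snd y = j})) =
      ennreal (f (j + 1, j) + (f (j, j) - f (j + 1, j)) / 2)"
proof -
  have s: "set_pmf target \<inter> {y. snd y = j} = {(j, j), (j + 1, j)}"
    using assms(1) by (auto simp: set_pmf_target state_space_def)
  have "pmf target (j + 1, j) = pmf target (j, j)" "pmf target (j, j) > 0"
    using assms(1) weight_total_pos by (auto simp: pmf_target weight_def state_space_def)
  then have r: "pmf target (j + 1, j) / (pmf target (j, j) + pmf target (j + 1, j)) = 1 / 2"
    by simp
  show "(\<integral>\<^sup>+z. ennreal (f z) \<partial>measure_pmf (cond_pmf target {y. snd y = j})) =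
      ennreal (f (j, j) + (f (j + 1, j) - f (j, j)) / 2)"
    using nn_integral_cond_pmf_pair[OF s, of f] f unfolding r by simp
  then show "(\<integral>\<^sup>+z. ennreal (f z) \<partial>measure_pmf (cond_pmf target {y. snd y = j})) =
      ennreal (f (j + 1, j) + (f (j, j) - f (j + 1, j)) / 2)"
    by (simp add: field_simps)
qed

text \<open>A column has weight \<open>1 / j^2\<close> on its lower state and
  \<open>1 / (j + 1)^2\<close> on its upper one. The upper state is thus chosen with probability
  below \<open>1 / 2\<close>, which is the downward pull of the target.\<close>

lemma target_column:
  fixes f :: "nat \<times> nat \<Rightarrow> real"
  assumes "j \<ge> 1" and f: "\<And>z. 0 \<le> f z"
  shows "(\<integral>\<^sup>+z. ennreal (f z) \<partial>measure_pmf (cond_pmf target {y. fst y = j + 1})) =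
      ennreal (f (j + 1, j) + (f (j + 1, j + 1) - f (j + 1, j)) * ((real j)\<^sup>2 / ((real j)\<^sup>2 + (real j + 1)\<^sup>2)))"
    and "(\<integral>\<^sup>+z. ennreal (f z) \<partial>measure_pmf (cond_pmf target {y. fst y = j + 1})) =
      ennreal (f (j + 1, j + 1) + (f (j + 1, j) - f (j + 1, j + 1)) * (1 - (real j)\<^sup>2 / ((real j)\<^sup>2 + (real j + 1)\<^sup>2)))"
proof -
  have s: "set_pmf target \<inter> {y. fst y = j + 1} = {(j + 1, j), (j + 1, j + 1)}"
    using assms(1) by (auto simp: set_pmf_target state_space_def)
  define c where "c = (real j)\<^sup>2"
  define d where "d = (real j + 1)\<^sup>2"
  define Z where "Z = (\<Sum>\<^sub>\<infinity>y\<in>state_space. weight y)"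
  have pos: "c > 0" "d > 0" "Z > 0"
    using assms(1) weight_total_pos by (auto simp: c_def d_def Z_def)
  have "pmf target (j + 1, j) = 1 / c / Z" "pmf target (j + 1, j + 1) = 1 / d / Z"
    using assms(1) by (auto simp: pmf_target weight_def state_space_def c_def d_def Z_def add.commute)
  moreover have "1 / d / Z / (1 / c / Z + 1 / d / Z) = c / (c + d)"
  proof -
    have "1 / c / Z + 1 / d / Z = (c + d) / (c * d * Z)"
      using pos by (simp add: field_simps)
    then show ?thesis
      using pos by simp
  qed
  ultimately have r: "pmf target (j + 1, j + 1) / (pmf target (j + 1, j) + pmf target (j + 1, j + 1)) = c / (c + d)"
    by simp
  show "(\<integral>\<^sup>+z. ennreal (f z) \<partial>measure_pmf (cond_pmf target {y. fst y = j + 1})) =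
      ennreal (f (j + 1, j) + (f (j + 1, j + 1) - f (j + 1, j)) * ((real j)\<^sup>2 / ((real j)\<^sup>2 + (real j + 1)\<^sup>2)))"
    unfolding c_def[symmetric] d_def[symmetric] r[symmetric] by (rule nn_integral_cond_pmf_pair[OF s f])
  moreover have "b + (t - b) * q = t + (b - t) * (1 - q)" for b t q :: real
    by (simp add: algebra_simps)
  ultimately show "(\<integral>\<^sup>+z. ennreal (f z) \<partial>measure_pmf (cond_pmf target {y. fst y = j + 1})) =
      ennreal (f (j + 1, j + 1) + (f (j + 1, j) - f (j + 1, j + 1)) * (1 - (real j)\<^sup>2 / ((real j)\<^sup>2 + (real j + 1)\<^sup>2)))"
    by (simp only:)
qed

text \<open>At the foot of the ladder the column has no second state, so redrawing the second
  coordinate leaves \<open>(1, 1)\<close> in place.\<close>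

lemma target_column_1:
  "(\<integral>\<^sup>+z. f z \<partial>measure_pmf (cond_pmf target {y. fst y = 1})) = f (1, 1)"
proof -
  have s: "set_pmf target \<inter> {y. fst y = 1} = {(1, 1)}"
    by (auto simp: set_pmf_target state_space_def)
  then have "set_pmf (cond_pmf target {y. fst y = 1}) = {(1, 1)}"
    by (subst set_cond_pmf) auto
  then have "cond_pmf target {y. fst y = 1} = return_pmf (1, 1)"
    using set_pmf_subset_singleton by (metis order_refl)
  then show ?thesis
    by simp
qed

text \<open>The rule with its bias parameter frozen at \<open>A\<close>, so that a single step can
  be analysed apart from the history. On both kinds of state the favoured coordinate is the one
  whose redraw can climb.\<close>

definition diagonal_selection :: "real \<Rightarrow> nat \<times> nat \<Rightarrow> real \<times> real" where
  "diagonal_selection A x =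
    (if fst x = snd x then (1/2 + 4 / A, 1/2 - 4 / A) else (1/2 - 4 / A, 1/2 + 4 / A))"

lemma diagonal_rule_eq: "diagonal_rule a h = diagonal_selection (a (length h)) (last h)"
  by (simp add: diagonal_rule_def diagonal_selection_def Let_def case_prod_beta)

section \<open>The ladder and its upward moves\<close>

definition height :: "nat \<times> nat \<Rightarrow> real" where
  "height x = real (fst x) + real (snd x)"

definition climb :: "nat \<times> nat \<Rightarrow> nat \<times> nat" where
  "climb x = (if fst x = snd x then (fst x + 1, snd x) else (fst x, snd x + 1))"

lemma climb_in_state_space: "x \<in> state_space \<Longrightarrow> climb x \<in> state_space"
  by (auto simp: climb_def state_space_def)

lemma height_climb: "height (climb x) = height x + 1"
  by (simp add: height_def climb_def)

text \<open>Positivity is enough to make an initial run of climbs of any length possible. The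
  favoured coordinate has positive selection probability, and its conditional law charges the next
  rung.\<close>

lemma pmf_gibbs_step_climb:
  assumes x: "x \<in> state_space" and A: "8 < A"
  shows "pmf (gibbs_step target (diagonal_selection A x) x) (climb x) > 0"
proof -
  \<comment> \<open>The mass of a point is the integral of its indicator, which brings the row and
    column formulas into play.\<close>
  let ?f = "indicator {climb x} :: _ \<Rightarrow> real"
  have A8: "4 / A < 1 / 2"
    using A by (simp add: field_simps)
  have "ennreal (pmf (gibbs_step target (diagonal_selection A x) x) (climb x)) =
      (\<integral>\<^sup>+y. ennreal (?f y) \<partial>measure_pmf (gibbs_step target (diagonal_selection A x) x))"
    by (simp add: ennreal_indicator emeasure_pmf_single)
  also have "\<dots> > 0"
  proof (cases "fst x = snd x")
    case True
    then obtain j where j: "x = (j, j)" "j \<ge> 1"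
      using x by (cases x) (auto simp: state_space_def)
    have "(\<integral>\<^sup>+y. ennreal (?f y) \<partial>measure_pmf (cond_pmf target {y. snd y = snd x})) = ennreal (1 / 2)"
      using j target_row(1)[of j ?f] by (simp add: climb_def del: divide_ennreal)
    moreover have "ennreal (1 / 2) > 0"
      by (subst ennreal_less_zero_iff) simp
    ultimately have "(\<integral>\<^sup>+y. ennreal (?f y) \<partial>measure_pmf (cond_pmf target {y. snd y = snd x})) > 0"
      by (simp only:)
    moreover have "ennreal (1 / 2 + 4 / A) > 0"
      using A by (subst ennreal_less_zero_iff) (simp add: add_pos_pos)
    ultimately show ?thesis
      using True x A A8 by (simp add: diagonal_selection_def nn_integral_gibbs_step set_pmf_target ennreal_zero_less_mult_iff add_pos_nonneg)
  next
    case False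
    then obtain j where j: "x = (j + 1, j)" "j \<ge> 1"
      using x by (cases x) (auto simp: state_space_def)
    have "(\<integral>\<^sup>+y. ennreal (?f y) \<partial>measure_pmf (cond_pmf target {y. fst y = fst x})) > 0"
      using j target_column(1)[of j ?f] by (simp add: climb_def add_pos_pos)
    moreover have "ennreal (1 / 2 + 4 / A) > 0"
      using A by (subst ennreal_less_zero_iff) (simp add: add_pos_pos)
    ultimately show ?thesis
      using False x A A8 by (simp add: diagonal_selection_def nn_integral_gibbs_step set_pmf_target ennreal_zero_less_mult_iff add_nonneg_pos)
  qed
  finally show ?thesis
    by simp
qed

text \<open>Rests on \<open>(1 - l + l^2) * (1 + l) = 1 + l^3\<close> and
  \<open>1 + l \<le> exp l\<close>.\<close>

lemma exp_minus_le_quadratic: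
  fixes l :: real
  assumes "0 \<le> l"
  shows "exp (- l) \<le> 1 - l + l\<^sup>2"
proof -
  have "1 \<le> 1 + l ^ 3"
    using assms by simp
  also have "\<dots> = (1 - l + l\<^sup>2) * (1 + l)"
    by (simp add: algebra_simps power2_eq_square power3_eq_cube)
  also have "\<dots> \<le> (1 - l + l\<^sup>2) * exp l"
  proof -
    have "0 \<le> (1 - l / 2)\<^sup>2 + 3 / 4 * l\<^sup>2"
      by simp
    then have "0 \<le> 1 - l + l\<^sup>2"
      by (simp add: power2_eq_square algebra_simps)
    then show ?thesis
      by (intro mult_left_mono) auto
  qed
  finally show ?thesis
    by (simp add: exp_minus divide_simps)
qed

text \<open>Here \<open>u\<close> and \<open>v\<close> are the probabilities of one rung up and one
  rung down, and \<open>\<delta>\<close> bounds the drift from below. Expanding both exponentials to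
  second order leaves \<open>- l * (u - v)\<close> and a quadratic term of at most
  \<open>(u + v) * l^2\<close>.\<close>

lemma drift_bound:
  fixes u v l \<delta> :: real
  assumes "0 \<le> u" "0 \<le> v" "u + v \<le> 1" "0 \<le> l" "l \<le> 1" "\<delta> \<le> u - v"
  shows "1 + u * (exp (- l) - 1) + v * (exp l - 1) \<le> 1 - l * \<delta> + l\<^sup>2"
proof -
  have "u * (exp (- l) - 1) \<le> u * (- l + l\<^sup>2)" "v * (exp l - 1) \<le> v * (l + l\<^sup>2)"
    using assms exp_minus_le_quadratic[of l] exp_bound[of l] by (auto intro!: mult_left_mono)
  moreover have "(u + v) * l\<^sup>2 \<le> l\<^sup>2" "l * \<delta> \<le> l * (u - v)"
    using assms by (auto intro!: mult_left_le_one_le mult_left_mono)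
  ultimately show ?thesis
    by (simp add: algebra_simps)
qed

text \<open>After cross-multiplication the two sides differ by exactly 1. For \<open>x = j\<close>
  the deficit from a fair coin is the reciprocal of the height of \<open>(j + 1, j)\<close>.\<close>

lemma column_ratio_bound:
  fixes x :: real
  assumes "x > 0"
  shows "1 / 2 - 1 / (2 * x + 1) \<le> x\<^sup>2 / (x\<^sup>2 + (x + 1)\<^sup>2)"
proof -
  have pos: "x\<^sup>2 + (x + 1)\<^sup>2 > 0"
    using assms by (simp add: add_pos_pos)
  have "(2 * x - 1) * (x\<^sup>2 + (x + 1)\<^sup>2) \<le> x\<^sup>2 * (2 * (2 * x + 1))"
    using assms by (simp add: power2_eq_square algebra_simps)
  then have "(2 * x - 1) / (2 * (2 * x + 1)) \<le> x\<^sup>2 / (x\<^sup>2 + (x + 1)\<^sup>2)"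
    using pos assms by (simp add: divide_simps mult.commute)
  moreover have "(2 * x - 1) / (2 * (2 * x + 1)) = 1 / 2 - 1 / (2 * x + 1)"
    using assms by (simp add: field_simps)
  ultimately show ?thesis
    by simp
qed

text \<open>Collects the two branches of a step into one real expression; the sign conditions keep
  \<open>ennreal\<close> from truncating, and \<open>s + t = 1\<close> gathers the constant
  terms.\<close>

lemma ennreal_mixture:
  assumes "0 \<le> s" "0 \<le> t" "s + t = 1" "0 \<le> c" "0 \<le> 1 + x" "0 \<le> 1 + y"
  shows "ennreal s * ennreal (c * (1 + x)) + ennreal t * ennreal (c * (1 + y)) = ennreal ((1 + s * x + t * y) * c)"
proof -
  have "ennreal s * ennreal (c * (1 + x)) + ennreal t * ennreal (c * (1 + y)) =
      ennreal (s * (c * (1 + x)) + t * (c * (1 + y)))"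
    using assms by (simp add: ennreal_mult)
  also have "s * (c * (1 + x)) + t * (c * (1 + y)) = (s + t + s * x + t * y) * c"
    by (simp add: algebra_simps)
  finally show ?thesis
    by (simp add: assms(3))
qed

text \<open>The bias gives the upward move an advantage of \<open>4 / A\<close>. The hypothesis on
  \<open>height x\<close> keeps the pull of the target at \<open>2 / A\<close> or less, so a drift
  of at least \<open>2 / A\<close> remains for \<open>drift_bound\<close>.\<close>

lemma nn_integral_gibbs_step_exp_height:
  assumes x: "x \<in> state_space" and A: "8 < A" "A / 2 \<le> height x - 1" and l: "0 \<le> l" "l \<le> 1"
  shows "(\<integral>\<^sup>+y. ennreal (exp (- l * height y))
      \<partial>measure_pmf (gibbs_step target (diagonal_selection A x) x)) \<le>
    ennreal ((1 - l * (2 / A) + l\<^sup>2) * exp (- l * height x))"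
proof -
  let ?f = "\<lambda>y. exp (- l * height y)"
  let ?s = "1 / 2 + 4 / A" and ?t = "1 / 2 - 4 / A"
  have st: "0 \<le> ?s" "0 \<le> ?t" "?s \<le> 1" "?t \<le> 1 / 2"
    using A by (auto simp: field_simps)
  have up: "?f (climb y) = ?f y * exp (- l)" for y
    by (simp add: height_climb algebra_simps flip: exp_add)
  \<comment> \<open>Common end of both cases: it remains to exhibit the probabilities
    \<open>u\<close> of moving up and \<open>v\<close> of moving down, with drift at least
    \<open>2 / A\<close>.\<close>
  have main: "(\<integral>\<^sup>+y. ennreal (?f y) \<partial>measure_pmf (gibbs_step target (diagonal_selection A x) x)) \<le>
      ennreal ((1 - l * (2 / A) + l\<^sup>2) * ?f x)"
    if "(\<integral>\<^sup>+y. ennreal (?f y) \<partial>measure_pmf (gibbs_step target (diagonal_selection A x) x)) =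
        ennreal ((1 + u * (exp (- l) - 1) + v * (exp l - 1)) * ?f x)"
      "0 \<le> u" "0 \<le> v" "u + v \<le> 1" "2 / A \<le> u - v" for u v
    unfolding that(1) using drift_bound[OF that(2-4) l that(5)]
    by (intro ennreal_leI mult_right_mono) auto
  show ?thesis
  proof (cases "fst x = snd x")
    case True
    then obtain j where j: "x = (j, j)" "j \<ge> 1"
      using x by (cases x) (auto simp: state_space_def)
    have row: "(\<integral>\<^sup>+y. ennreal (?f y) \<partial>measure_pmf (cond_pmf target {y. snd y = snd x})) =
        ennreal (?f x * (1 + (exp (- l) - 1) / 2))"
      using up[of x] j target_row(1)[of j ?f] by (simp add: climb_def field_simps)
    \<comment> \<open>\<open>q\<close> is the probability that redrawing the second coordinate
      descends: 0 at the foot of the ladder, \<open>1 - r\<close> elsewhere.\<close>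
    have "\<exists>q\<ge>0. q \<le> 1 \<and> q \<le> 1 / 2 + 2 / A \<and>
        (\<integral>\<^sup>+y. ennreal (?f y) \<partial>measure_pmf (cond_pmf target {y. fst y = fst x})) =
          ennreal (?f x * (1 + q * (exp l - 1)))"
    proof (cases "j = 1")
      case True
      then show ?thesis
        using j A target_column_1[of ?f] by (intro exI[of _ 0]) auto
    next
      case False
      define i where "i = j - 1"
      have i: "j = i + 1" "i \<ge> 1"
        using j(2) False by (auto simp: i_def)
      define r where "r = (real i)\<^sup>2 / ((real i)\<^sup>2 + (real i + 1)\<^sup>2)"
      have r: "0 \<le> r" "r \<le> 1" "1 / 2 - 1 / (2 * real i + 1) \<le> r"
        using i column_ratio_bound[of "real i"] by (simp_all add: r_def divide_le_eq not_less)
      \<comment> \<open>The column ratio on the diagonal belongs to the state one rung below, whose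
        height is \<open>2 * i + 1\<close>; hence the \<open>- 1\<close> in the hypothesis on
        \<open>height x\<close>.\<close>
      have "A / 2 \<le> 2 * real i + 1"
        using A j i by (simp add: height_def)
      then have "1 / (2 * real i + 1) \<le> 1 / (A / 2)"
        using A by (intro divide_left_mono) auto
      moreover have "?f (i + 1, i) = ?f x * exp l"
        using j i by (simp add: height_def algebra_simps flip: exp_add)
      ultimately show ?thesis
        using r i j target_column(2)[of i ?f, folded r_def]
        by (intro exI[of _ "1 - r"]) (auto simp: algebra_simps)
    qed
    then obtain q where q: "0 \<le> q" "q \<le> 1" "q \<le> 1 / 2 + 2 / A" and
      col: "(\<integral>\<^sup>+y. ennreal (?f y) \<partial>measure_pmf (cond_pmf target {y. fst y = fst x})) =
          ennreal (?f x * (1 + q * (exp l - 1)))"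
      by blast
    \<comment> \<open>With \<open>e = 1 / A\<close>, the products \<open>?t * q\<close> and
      \<open>?t * (2 / A)\<close> enter as atoms \<open>w\<close> and \<open>z\<close>, which leaves
      linear arithmetic.\<close>
    have arith: "2 * e \<le> s / 2 - w \<and> s / 2 + w \<le> 1"
      if "w \<le> t / 2 + z" "z \<le> e" "w \<le> 1 / 2" "s = 1 / 2 + 4 * e" "t = 1 / 2 - 4 * e" "0 < e" "s \<le> 1"
      for e s t w z :: real
      using that by linarith
    have "2 * (1 / A) \<le> ?s / 2 - ?t * q \<and> ?s / 2 + ?t * q \<le> 1"
    proof (rule arith[where t = ?t])
      show "?t * q \<le> ?t / 2 + ?t * (2 / A)"
        using mult_left_mono[OF q(3) st(2)] by (simp add: distrib_left)
      have "?t * (2 / A) \<le> 1 / 2 * (2 / A)"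
        using st A by (intro mult_right_mono) auto
      then show "?t * (2 / A) \<le> 1 / A"
        by simp
      have "?t * q \<le> 1 / 2 * 1"
        using st q by (intro mult_mono) auto
      then show "?t * q \<le> 1 / 2"
        by simp
    qed (use A st(3) in auto)
    then have "2 / A \<le> ?s / 2 - ?t * q" "?s / 2 + ?t * q \<le> 1"
      by simp_all
    moreover have "(\<integral>\<^sup>+y. ennreal (?f y) \<partial>measure_pmf (gibbs_step target (diagonal_selection A x) x)) =
        ennreal ?s * ennreal (?f x * (1 + (exp (- l) - 1) / 2)) + ennreal ?t * ennreal (?f x * (1 + q * (exp l - 1)))"
      using True st x unfolding row[symmetric] col[symmetric]
      by (simp add: diagonal_selection_def nn_integral_gibbs_step set_pmf_target)
    moreover have "\<dots> = ennreal ((1 + ?s / 2 * (exp (- l) - 1) + ?t * q * (exp l - 1)) * ?f x)"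
    proof -
      have "0 \<le> q * (exp l - 1)"
        using q l by simp
      then have "0 \<le> 1 + q * (exp l - 1)"
        by simp
      moreover have "0 \<le> 1 + (exp (- l) - 1) / 2"
        by (simp add: field_simps add_nonneg_nonneg)
      ultimately show ?thesis
        using ennreal_mixture[OF st(1,2), of "?f x" "(exp (- l) - 1) / 2" "q * (exp l - 1)"]
        by (simp add: mult.assoc)
    qed
    ultimately show ?thesis
      using st q by (intro main[of "?s / 2" "?t * q"]) auto
  next
    case False
    then obtain j where j: "x = (j + 1, j)" "j \<ge> 1"
      using x by (cases x) (auto simp: state_space_def)
    define r where "r = (real j)\<^sup>2 / ((real j)\<^sup>2 + (real j + 1)\<^sup>2)"
    have r: "0 \<le> r" "r \<le> 1 / 2" "1 / 2 - 1 / (2 * real j + 1) \<le> r"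
      using j column_ratio_bound[of "real j"]
      by (auto simp: r_def divide_simps power2_eq_square algebra_simps)
    have row: "(\<integral>\<^sup>+y. ennreal (?f y) \<partial>measure_pmf (cond_pmf target {y. snd y = snd x})) =
        ennreal (?f x * (1 + (exp l - 1) / 2))"
    proof -
      have "?f (j, j) = ?f x * exp l"
        using j by (simp add: height_def algebra_simps flip: exp_add)
      then show ?thesis
        using j target_row(2)[of j ?f] by (simp add: field_simps)
    qed
    have col: "(\<integral>\<^sup>+y. ennreal (?f y) \<partial>measure_pmf (cond_pmf target {y. fst y = fst x})) =
        ennreal (?f x * (1 + r * (exp (- l) - 1)))"
      using up[of x] j target_column(1)[of j ?f, folded r_def] by (simp add: climb_def algebra_simps)
    have "A / 2 \<le> 2 * real j + 1"
      using A j by (simp add: height_def)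
    then have "1 / (2 * real j + 1) \<le> 1 / (A / 2)"
      using A by (intro divide_left_mono) auto
    then have lower: "1 / 2 - 2 / A \<le> r"
      using r by simp
    \<comment> \<open>Here \<open>?s\<close> is bounded only by 1, so the pull may cost
      \<open>2 / A\<close> instead of \<open>1 / A\<close>; of the advantage \<open>4 / A\<close>
      exactly the required \<open>2 / A\<close> is left.\<close>
    have arith: "2 * e \<le> w - t / 2 \<and> w + t / 2 \<le> 1"
      if "s / 2 - z \<le> w" "z \<le> 2 * e" "w \<le> 1 / 2" "s = 1 / 2 + 4 * e" "t = 1 / 2 - 4 * e" "t \<le> 1 / 2"
      for e s t w z :: real
      using that by linarith
    have "2 * (1 / A) \<le> ?s * r - ?t / 2 \<and> ?s * r + ?t / 2 \<le> 1"
    proof (rule arith[where s = ?s])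
      show "?s / 2 - ?s * (2 / A) \<le> ?s * r"
        using mult_left_mono[OF lower st(1)] by (simp add: right_diff_distrib)
      have "?s * (2 / A) \<le> 1 * (2 / A)"
        using st A by (intro mult_right_mono) auto
      then show "?s * (2 / A) \<le> 2 * (1 / A)"
        by simp
      have "?s * r \<le> 1 * (1 / 2)"
        using st r by (intro mult_mono) auto
      then show "?s * r \<le> 1 / 2"
        by simp
    qed (use st(4) in auto)
    then have "2 / A \<le> ?s * r - ?t / 2" "?s * r + ?t / 2 \<le> 1"
      by simp_all
    moreover have "(\<integral>\<^sup>+y. ennreal (?f y) \<partial>measure_pmf (gibbs_step target (diagonal_selection A x) x)) =
        ennreal ?t * ennreal (?f x * (1 + (exp l - 1) / 2)) + ennreal ?s * ennreal (?f x * (1 + r * (exp (- l) - 1)))"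
      using False st x unfolding row[symmetric] col[symmetric]
      by (simp add: diagonal_selection_def nn_integral_gibbs_step set_pmf_target)
    moreover have "\<dots> = ennreal ((1 + ?s * r * (exp (- l) - 1) + ?t / 2 * (exp l - 1)) * ?f x)"
    proof -
      have "0 \<le> (1 - r) + r * exp (- l)"
        using r by (intro add_nonneg_nonneg) auto
      then have "0 \<le> 1 + r * (exp (- l) - 1)"
        by (simp add: algebra_simps)
      moreover have "0 \<le> 1 + (exp l - 1) / 2"
        by (simp add: field_simps add_nonneg_nonneg)
      ultimately show ?thesis
        using ennreal_mixture[OF st(2,1), of "?f x" "(exp l - 1) / 2" "r * (exp (- l) - 1)"]
        by (simp add: mult.assoc add.commute add.left_commute)
    qed
    ultimately show ?thesis
      using st r by (intro main[of "?s * r" "?t / 2"]) auto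
  qed
qed


section \<open>Escape along a slowly vanishing bias\<close>

definition climb_path :: "nat \<Rightarrow> nat \<times> nat" where
  "climb_path n = (climb ^^ n) (1, 1)"

lemma climb_path_simps:
  "climb_path 0 = (1, 1)" "climb_path (Suc n) = climb (climb_path n)"
  by (simp_all add: climb_path_def)

lemma climb_path_in_state_space: "climb_path n \<in> state_space"
  by (induction n) (auto simp: climb_path_simps climb_in_state_space, simp add: state_space_def)

lemma height_climb_path: "height (climb_path n) = real n + 2"
  by (induction n) (simp_all add: climb_path_simps height_climb, simp add: height_def)

lemma one_in_target: "(1, 1) \<in> set_pmf target"
  by (simp add: set_pmf_target state_space_def)

text \<open>By \<open>a_slow\<close>, height at least \<open>a n\<close> at time \<open>n\<close>
  meets the height requirement of the next step, whose parameter is \<open>a (Suc n)\<close>.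
  Monotonicity lets one exponent serve all steps up to a time horizon.\<close>

locale slow_bias =
  fixes a :: "nat \<Rightarrow> real"
  assumes a_gt: "\<And>n. 8 < a n" and a_incseq: "incseq a"
    and a_slow: "\<And>n. a (Suc n) / 2 \<le> a n - 1"
begin

abbreviation history :: "nat \<Rightarrow> (nat \<times> nat) list pmf" where
  "history \<equiv> gibbs_history target (diagonal_rule a) (1, 1)"

abbreviation chain :: "(nat \<Rightarrow> nat \<times> nat) measure" where
  "chain \<equiv> gibbs_chain target (diagonal_rule a) (1, 1)"

definition climb_prob :: "nat \<Rightarrow> real" where
  "climb_prob n = pmf (history n) (map climb_path [0..<Suc n])"

lemma climb_prob_pos: "climb_prob n > 0"
proof (induction n)
  case 0
  then show ?case
    by (simp add: climb_prob_def climb_path_simps)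
next
  case (Suc n)
  let ?h = "map climb_path [0..<Suc n]"
  \<comment> \<open>A history of length \<open>Suc n\<close> decides step \<open>Suc n\<close>,
    hence the index in \<open>a (Suc n)\<close>.\<close>
  have "last ?h = climb_path n" "length ?h = Suc n"
    by simp_all
  then have "climb_prob (Suc n) = climb_prob n *
      pmf (gibbs_step target (diagonal_selection (a (Suc n)) (climb_path n)) (climb_path n)) (climb (climb_path n))"
    using pmf_gibbs_history_append[of target "diagonal_rule a" "(1, 1)" n ?h "climb_path (Suc n)"]
    by (simp add: climb_prob_def diagonal_rule_eq climb_path_simps)
  then show ?case
    using Suc.IH pmf_gibbs_step_climb[OF climb_path_in_state_space a_gt] by simp
qed

lemma emeasure_climb: "emeasure chain {\<omega>. \<forall>i\<le>n. \<omega> i = climb_path i} = ennreal (climb_prob n)"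
  unfolding climb_prob_def by (rule gibbs_chain_path)

text \<open>The height condition stops short of time \<open>k\<close>, so that a first drop at
  \<open>k\<close> itself is still possible within the event.\<close>

definition stays_high :: "nat \<Rightarrow> nat \<Rightarrow> (nat \<times> nat) list \<Rightarrow> bool" where
  "stays_high N k h \<longleftrightarrow> (\<forall>i\<le>N. h ! i = climb_path i) \<and> (\<forall>m. N \<le> m \<and> m < k \<longrightarrow> a m \<le> height (h ! m))"

text \<open>The exponent \<open>1 / a K\<close> of the time horizon \<open>K\<close> is admissible at all earlier steps because
  the drift \<open>2 / a k\<close> decreases with time.\<close>

lemma nn_integral_stays_high:
  assumes "N \<le> k" "k \<le> K"
  defines "l \<equiv> 1 / a K"
  shows "(\<integral>\<^sup>+h. indicator {h. stays_high N k h} h * ennreal (exp (- l * height (h ! k))) \<partial>measure_pmf (history k)) \<le>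
    ennreal (climb_prob N * exp (- l * (real N + 2)) * (1 - l\<^sup>2) ^ (k - N))"
proof -
  have l: "0 < l" "l \<le> 1"
    using a_gt[of K] by (auto simp: l_def)
  then have l2: "0 \<le> 1 - l\<^sup>2"
    by (simp add: power_le_one)
  show ?thesis
    using assms(1,2)
  proof (induction k rule: dec_induct)
    case base
    let ?c = "map climb_path [0..<Suc N]"
    \<comment> \<open>At \<open>k = N\<close> the height condition is void and the climb fixes the
      whole list, which ends at height \<open>N + 2\<close>.\<close>
    have "indicator {h. stays_high N N h} h * ennreal (exp (- l * height (h ! N))) =
        ennreal (exp (- l * (real N + 2))) * indicator {?c} h" if "h \<in> set_pmf (history N)" for h
    proof -
      have "length h = Suc N"
        using set_gibbs_history[OF one_in_target that] by simp
      then have "stays_high N N h \<longleftrightarrow> h = ?c"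
        by (auto simp: stays_high_def list_eq_iff_nth_eq less_Suc_eq_le simp del: upt_Suc)
      moreover have "?c ! N = climb_path N"
        by (simp del: upt_Suc)
      ultimately show ?thesis
        by (auto simp: indicator_def height_climb_path simp del: upt_Suc)
    qed
    then have "(\<integral>\<^sup>+h. indicator {h. stays_high N N h} h * ennreal (exp (- l * height (h ! N))) \<partial>measure_pmf (history N)) =
        (\<integral>\<^sup>+h. ennreal (exp (- l * (real N + 2))) * indicator {?c} h \<partial>measure_pmf (history N))"
      by (intro nn_integral_cong_AE AE_pmfI)
    also have "\<dots> = ennreal (exp (- l * (real N + 2))) * ennreal (climb_prob N)"
      by (simp add: nn_integral_cmult emeasure_pmf_single climb_prob_def del: upt_Suc)
    also have "\<dots> = ennreal (climb_prob N * exp (- l * (real N + 2)) * (1 - l\<^sup>2) ^ (N - N))"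
      using climb_prob_pos[of N] by (simp add: mult.commute flip: ennreal_mult)
    finally show ?case
      by simp
  next
    case (step k)
    let ?E = "\<lambda>x. ennreal (exp (- l * height x))"
    have rate: "1 - l * (2 / a (Suc k)) + l\<^sup>2 \<le> 1 - l\<^sup>2"
    proof -
      have "a (Suc k) \<le> a K"
        using step.prems a_incseq by (simp add: incseq_def)
      then have "l \<le> 1 / a (Suc k)"
        unfolding l_def using a_gt[of "Suc k"] a_gt[of K] by (intro divide_left_mono) auto
      then have "l * l \<le> l * (1 / a (Suc k))"
        using l by (intro mult_left_mono) auto
      moreover have "l * (2 / a (Suc k)) = 2 * (l * (1 / a (Suc k)))"
        by simp
      ultimately show ?thesis
        unfolding power2_eq_square by linarith
    qed
    \<comment> \<open>If the event has failed or the height at time \<open>k\<close> is below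
      \<open>a k\<close>, the left side vanishes; otherwise the drift estimate applies with
      \<open>A = a (Suc k)\<close>.\<close>
    have one_step: "(\<integral>\<^sup>+x. indicator {h. stays_high N (Suc k) h} (h @ [x]) * ?E ((h @ [x]) ! Suc k)
          \<partial>measure_pmf (gibbs_step target (diagonal_rule a h) (last h))) \<le>
        ennreal (1 - l\<^sup>2) * (indicator {h. stays_high N k h} h * ?E (h ! k))"
      if h: "h \<in> set_pmf (history k)" for h
    proof -
      have len: "length h = Suc k" and sub: "set h \<subseteq> state_space"
        using set_gibbs_history[OF one_in_target h] by (auto simp: set_pmf_target)
      have last: "last h = h ! k"
        using len by (subst last_conv_nth) auto
      have "h ! k \<in> state_space"
        using len sub by (metis lessI nth_mem subsetD)
      have iff: "stays_high N (Suc k) (h @ [x]) \<longleftrightarrow> stays_high N k h \<and> a k \<le> height (h ! k)" for x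
        using len step.hyps unfolding stays_high_def
        by (auto simp: nth_append less_Suc_eq_le le_less)
      show ?thesis
      proof (cases "stays_high N k h \<and> a k \<le> height (h ! k)")
        case False
        then show ?thesis
          by (simp add: iff)
      next
        case True
        have "(\<integral>\<^sup>+x. ?E x \<partial>measure_pmf (gibbs_step target (diagonal_rule a h) (last h))) \<le>
            ennreal ((1 - l * (2 / a (Suc k)) + l\<^sup>2) * exp (- l * height (h ! k)))"
          unfolding diagonal_rule_eq len last
        proof (rule nn_integral_gibbs_step_exp_height)
          show "a (Suc k) / 2 \<le> height (h ! k) - 1"
            using True a_slow[of k] by linarith
        qed (use l a_gt \<open>h ! k \<in> state_space\<close> in auto)
        also have "\<dots> \<le> ennreal ((1 - l\<^sup>2) * exp (- l * height (h ! k)))"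
          using rate by (intro ennreal_leI mult_right_mono) auto
        finally show ?thesis
          using True l2 len by (simp add: iff nth_append ennreal_mult)
      qed
    qed
    have "(\<integral>\<^sup>+h. indicator {h. stays_high N (Suc k) h} h * ?E (h ! Suc k) \<partial>measure_pmf (history (Suc k))) =
        (\<integral>\<^sup>+h. (\<integral>\<^sup>+x. indicator {h. stays_high N (Suc k) h} (h @ [x]) * ?E ((h @ [x]) ! Suc k)
          \<partial>measure_pmf (gibbs_step target (diagonal_rule a h) (last h))) \<partial>measure_pmf (history k))"
      by simp
    also have "\<dots> \<le> (\<integral>\<^sup>+h. ennreal (1 - l\<^sup>2) * (indicator {h. stays_high N k h} h * ?E (h ! k)) \<partial>measure_pmf (history k))"
      by (intro nn_integral_mono_AE AE_pmfI one_step)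
    also have "\<dots> = ennreal (1 - l\<^sup>2) * (\<integral>\<^sup>+h. indicator {h. stays_high N k h} h * ?E (h ! k) \<partial>measure_pmf (history k))"
      by (simp add: nn_integral_cmult)
    also have "\<dots> \<le> ennreal (1 - l\<^sup>2) * ennreal (climb_prob N * exp (- l * (real N + 2)) * (1 - l\<^sup>2) ^ (k - N))"
      using step by (intro mult_left_mono) auto
    also have "\<dots> = ennreal (climb_prob N * exp (- l * (real N + 2)) * (1 - l\<^sup>2) ^ (Suc k - N))"
      using l2 step.hyps by (simp add: Suc_diff_le algebra_simps flip: ennreal_mult')
    finally show ?case .
  qed
qed

text \<open>Failures after the climb are sorted by the first drop time, because the exponential
  moment is controlled only while the walk has stayed high.\<close>

definition drop_event :: "nat \<Rightarrow> nat \<Rightarrow> (nat \<Rightarrow> nat \<times> nat) set" where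
  "drop_event N k = {\<omega>. (\<forall>i\<le>N. \<omega> i = climb_path i) \<and>
    (\<forall>m. N \<le> m \<and> m < k \<longrightarrow> a m \<le> height (\<omega> m)) \<and> height (\<omega> k) < a k}"

lemma sets_drop_event [measurable]: "drop_event N k \<in> sets chain"
proof -
  have "drop_event N k = {\<omega> \<in> space chain. (\<forall>i\<le>N. \<omega> i = climb_path i) \<and>
      (\<forall>m. N \<le> m \<and> m < k \<longrightarrow> a m \<le> height (\<omega> m)) \<and> height (\<omega> k) < a k}"
    by (simp add: drop_event_def space_gibbs_chain)
  also have "\<dots> \<in> sets chain"
    by measurable
  finally show ?thesis .
qed

text \<open>Markov's inequality for \<open>exp (- height / a k)\<close>, which is at least
  \<open>exp (- 1)\<close> when the height is below \<open>a k\<close>; this is the origin of the 1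
  in the exponent.\<close>

lemma emeasure_drop_event:
  assumes "N \<le> k"
  shows "emeasure chain (drop_event N k) \<le> ennreal (climb_prob N * exp (1 - real k / (a k)\<^sup>2))"
proof -
  define l where "l = 1 / a k"
  have l: "0 < l" "l \<le> 1"
    using a_gt[of k] by (auto simp: l_def)
  then have l2: "0 \<le> 1 - l\<^sup>2"
    by (simp add: power_le_one)
  have "drop_event N k = {\<omega>. stays_high N k (map \<omega> [0..<Suc k]) \<and> height (map \<omega> [0..<Suc k] ! k) < a k}"
    using assms by (auto simp: drop_event_def stays_high_def simp del: upt_Suc)
  then have "emeasure chain (drop_event N k) =
      emeasure (measure_pmf (history k)) {h. stays_high N k h \<and> height (h ! k) < a k}"
    using emeasure_gibbs_chain_history[OF one_in_target, of "diagonal_rule a" "\<lambda>h. stays_high N k h \<and> height (h ! k) < a k" k]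
    by simp
  also have "\<dots> = (\<integral>\<^sup>+h. indicator {h. stays_high N k h \<and> height (h ! k) < a k} h \<partial>measure_pmf (history k))"
    by simp
  also have "\<dots> \<le> (\<integral>\<^sup>+h. ennreal (exp 1) * (indicator {h. stays_high N k h} h * ennreal (exp (- l * height (h ! k)))) \<partial>measure_pmf (history k))"
  proof (intro nn_integral_mono)
    fix h
    have "1 \<le> exp 1 * exp (- l * height (h ! k))" if "height (h ! k) < a k"
      using that a_gt[of k] by (simp add: l_def flip: exp_add)
    then show "indicator {h. stays_high N k h \<and> height (h ! k) < a k} h \<le>
        ennreal (exp 1) * (indicator {h. stays_high N k h} h * ennreal (exp (- l * height (h ! k))))"
      by (auto simp: indicator_def simp flip: ennreal_mult')
  qed
  also have "\<dots> = ennreal (exp 1) * (\<integral>\<^sup>+h. indicator {h. stays_high N k h} h * ennreal (exp (- l * height (h ! k))) \<partial>measure_pmf (history k))"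
    by (simp add: nn_integral_cmult)
  also have "\<dots> \<le> ennreal (exp 1) * ennreal (climb_prob N * exp (- l * (real N + 2)) * (1 - l\<^sup>2) ^ (k - N))"
    using nn_integral_stays_high[OF assms order_refl] by (intro mult_left_mono) (auto simp: l_def)
  also have "\<dots> = ennreal (climb_prob N * (exp 1 * exp (- l * (real N + 2)) * (1 - l\<^sup>2) ^ (k - N)))"
    by (simp add: algebra_simps flip: ennreal_mult')
  also have "\<dots> \<le> ennreal (climb_prob N * exp (1 - real k / (a k)\<^sup>2))"
  proof (intro ennreal_leI mult_left_mono)
    have "(1 - l\<^sup>2) ^ (k - N) \<le> exp (- l\<^sup>2) ^ (k - N)"
      using l2 exp_ge_add_one_self[of "- l\<^sup>2"] by (intro power_mono) auto
    also have "\<dots> = exp (- (real k - real N) * l\<^sup>2)"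
      using assms by (simp add: of_nat_diff algebra_simps flip: exp_of_nat_mult)
    finally have "exp 1 * exp (- l * (real N + 2)) * (1 - l\<^sup>2) ^ (k - N) \<le>
        exp 1 * exp (- l * (real N + 2)) * exp (- (real k - real N) * l\<^sup>2)"
      by (intro mult_left_mono) auto
    also have "\<dots> = exp (1 - l * (real N + 2) - (real k - real N) * l\<^sup>2)"
      by (simp add: algebra_simps flip: exp_add)
    also have "\<dots> \<le> exp (1 - real k * l\<^sup>2)"
    proof -
      \<comment> \<open>The decay covers only the steps after \<open>N\<close>. The height gained by
        the climb pays for the others: its factor \<open>exp (- l * N)\<close> is at most
        \<open>exp (- N * l^2)\<close>.\<close>
      have "real N * l\<^sup>2 \<le> real N * l"
        using l by (intro mult_left_mono) (auto simp: power2_eq_square mult_left_le_one_le)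
      then show ?thesis
        using l by (simp add: algebra_simps)
    qed
    also have "real k * l\<^sup>2 = real k / (a k)\<^sup>2"
      by (simp add: l_def power_divide)
    finally show "exp 1 * exp (- l * (real N + 2)) * (1 - l\<^sup>2) ^ (k - N) \<le> exp (1 - real k / (a k)\<^sup>2)" .
  qed (use climb_prob_pos[of N] in simp)
  finally show ?thesis .
qed

text \<open>Every bound on a first drop carries the factor \<open>climb_prob N\<close>. Comparing
  all drops with the climb itself therefore only needs a tail sum below 1, however unlikely the
  climb is.\<close>

lemma prob_stays_above_pos:
  assumes summable: "summable (\<lambda>k. exp (1 - real k / (a k)\<^sup>2))"
  obtains N where "measure chain {\<omega>. \<forall>m\<ge>N. a m \<le> height (\<omega> m)} > 0"
proof -
  let ?t = "\<lambda>k. exp (1 - real k / (a k)\<^sup>2)"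
  interpret prob_space chain
    by (rule prob_space_gibbs_chain)
  obtain N where N: "norm (\<Sum>i. ?t (i + N)) < 1"
    using suminf_exist_split[OF zero_less_one summable] by blast
  let ?E = "{\<omega>. \<forall>i\<le>N. \<omega> i = climb_path i}"
  let ?D = "\<Union>i. drop_event N (i + N)"
  have [measurable]: "?E \<in> sets chain"
  proof -
    have "?E = {\<omega> \<in> space chain. \<forall>i\<le>N. \<omega> i = climb_path i}"
      by (simp add: space_gibbs_chain)
    also have "\<dots> \<in> sets chain"
      by measurable
    finally show ?thesis .
  qed
  have E: "measure chain ?E = climb_prob N"
    using emeasure_climb[of N] climb_prob_pos[of N] by (simp add: measure_def)
  have drop: "measure chain (drop_event N (i + N)) \<le> climb_prob N * ?t (i + N)" for i
    using emeasure_drop_event[OF le_add2[of N i]] climb_prob_pos[of N] unfolding emeasure_eq_measure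
    by (subst (asm) ennreal_le_iff) auto
  have s: "summable (\<lambda>i. ?t (i + N))"
    using summable by (rule summable_ignore_initial_segment)
  then have s': "summable (\<lambda>i. measure chain (drop_event N (i + N)))"
    using drop by (intro summable_comparison_test'[OF summable_mult[OF s, of "climb_prob N"]]) auto
  have "measure chain ?D \<le> (\<Sum>i. measure chain (drop_event N (i + N)))"
    using s' sets_drop_event by (intro finite_measure_subadditive_countably) blast+
  also have "\<dots> \<le> (\<Sum>i. climb_prob N * ?t (i + N))"
    using s s' drop by (intro suminf_le summable_mult) auto
  also have "\<dots> = climb_prob N * (\<Sum>i. ?t (i + N))"
    using s by (rule suminf_mult)
  also have "\<dots> < climb_prob N"
    using N climb_prob_pos[of N] by simp
  finally have "0 < measure chain ?E - measure chain ?D"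
    unfolding E by linarith
  also have "\<dots> \<le> measure chain (?E - ?D)"
    using sets_drop_event by (intro measure_diff_le_measure_setdiff) (auto simp only: fmeasurable_eq_sets intro!: sets.countable_UN' \<open>?E \<in> sets chain\<close>)
  also have "\<dots> \<le> measure chain {\<omega>. \<forall>m\<ge>N. a m \<le> height (\<omega> m)}"
  proof (rule finite_measure_mono)
    have "a m \<le> height (\<omega> m)" if \<omega>: "\<omega> \<in> ?E - ?D" and "N \<le> m" for \<omega> m
      using \<open>N \<le> m\<close>
    proof (induction m rule: less_induct)
      case (less m)
      \<comment> \<open>The index \<open>(m - N) + N\<close> is \<open>m\<close>. The induction
        supplies the earlier heights, so avoiding this event forces
        \<open>a m \<le> height (\<omega> m)\<close>.\<close>
      have "\<omega> \<notin> drop_event N ((m - N) + N)"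
        using \<omega> by blast
      then show ?case
        using \<omega> less by (fastforce simp: drop_event_def)
    qed
    then show "?E - ?D \<subseteq> {\<omega>. \<forall>m\<ge>N. a m \<le> height (\<omega> m)}"
      by blast
    have "{\<omega>. \<forall>m\<ge>N. a m \<le> height (\<omega> m)} = {\<omega> \<in> space chain. \<forall>m\<ge>N. a m \<le> height (\<omega> m)}"
      by (simp add: space_gibbs_chain)
    also have "\<dots> \<in> sets chain"
      by measurable
    finally show "{\<omega>. \<forall>m\<ge>N. a m \<le> height (\<omega> m)} \<in> sets chain" .
  qed
  finally show thesis
    by (rule that)
qed

end


section \<open>Failure of convergence\<close>

text \<open>On the ladder the height is at most twice the first coordinate, so once
  \<open>b n > 2 * K\<close> the escaping trajectories miss
  \<open>{x. fst x \<le> K}\<close>.\<close>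

lemma measure_gibbs_law_escape:
  assumes N: "measure (gibbs_chain target R x0) {\<omega>. \<forall>m\<ge>N. b m \<le> height (\<omega> m)} \<ge> \<epsilon>"
    and x0: "x0 \<in> set_pmf target" and b: "filterlim b at_top sequentially"
  shows "eventually (\<lambda>n. measure (gibbs_law target R x0 n) {x. fst x \<le> K} \<le> 1 - \<epsilon>) sequentially"
proof -
  let ?M = "gibbs_chain target R x0"
  interpret prob_space ?M
    by (rule prob_space_gibbs_chain)
  have [simp]: "space ?M = UNIV"
    by (rule space_gibbs_chain)
  have "eventually (\<lambda>n. b n > 2 * real K) sequentially"
    using b by (simp add: filterlim_at_top_dense)
  then have "eventually (\<lambda>n. n \<ge> N \<and> b n > 2 * real K) sequentially"
    using eventually_ge_at_top[of N] by eventually_elim simp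
  then show ?thesis
  proof eventually_elim
    case (elim n)
    have m: "{\<omega>. fst (\<omega> n) \<le> K} \<in> sets ?M"
    proof -
      have "{\<omega> \<in> space ?M. fst (\<omega> n) \<le> K} \<in> sets ?M"
        by measurable
      then show ?thesis
        by simp
    qed
    have "\<epsilon> \<le> prob {\<omega>. \<forall>m\<ge>N. b m \<le> height (\<omega> m)}"
      by (rule N)
    also have "\<dots> \<le> prob (space ?M - {\<omega>. fst (\<omega> n) \<le> K})"
    proof (rule finite_measure_mono_AE)
      show "AE \<omega> in ?M. \<omega> \<in> {\<omega>. \<forall>m\<ge>N. b m \<le> height (\<omega> m)} \<longrightarrow>
          \<omega> \<in> space ?M - {\<omega>. fst (\<omega> n) \<le> K}"
        using AE_gibbs_chain_in_support[OF x0, of R]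
      proof eventually_elim
        case (elim \<omega>)
        then have "\<omega> n \<in> state_space"
          by (simp add: set_pmf_target)
        then have "height (\<omega> n) \<le> 2 * real (fst (\<omega> n))"
          by (auto simp: state_space_def height_def)
        then show ?case
          using \<open>n \<ge> N \<and> b n > 2 * real K\<close> by force
      qed
    qed (rule sets.compl_sets[OF m])
    also have "\<dots> = 1 - prob {\<omega>. fst (\<omega> n) \<le> K}"
      by (rule prob_compl[OF m])
    also have "prob {\<omega>. fst (\<omega> n) \<le> K} = measure (gibbs_law target R x0 n) {x. fst x \<le> K}"
      by (simp add: measure_def emeasure_gibbs_law)
    finally show ?case
      by simp
  qed
qed

lemma pmf_mass_fst_le:
  fixes \<nu> :: "(nat \<times> 'b) pmf"
  assumes "\<epsilon> > 0"
  obtains K where "measure \<nu> {x. fst x \<le> K} > 1 - \<epsilon>"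
proof -
  have "(\<lambda>K. measure \<nu> {x. fst x \<le> K}) \<longlonglongrightarrow> measure \<nu> (\<Union>K. {x. fst x \<le> K})"
    by (intro measure_pmf.finite_Lim_measure_incseq) (auto simp: incseq_def)
  moreover have "(\<Union>K. {x :: nat \<times> 'b. fst x \<le> K}) = UNIV"
    by auto
  ultimately have "(\<lambda>K. measure \<nu> {x. fst x \<le> K}) \<longlonglongrightarrow> 1"
    using measure_pmf.prob_space[of \<nu>] by simp
  then have "eventually (\<lambda>K. measure \<nu> {x. fst x \<le> K} > 1 - \<epsilon>) sequentially"
    using assms by (intro order_tendstoD) auto
  then show thesis
    using that by (auto simp: eventually_sequentially)
qed

text \<open>A probability distribution puts more than \<open>1 - \<epsilon>\<close> on some
  \<open>{x. fst x \<le> K}\<close>, while the upper bound \<open>1 - \<epsilon>\<close> would pass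
  to the limit.\<close>

lemma not_convergent_if_escape:
  fixes \<mu> :: "nat \<Rightarrow> (nat \<times> 'b) measure"
  assumes "\<epsilon> > 0" and escape: "\<And>K. eventually (\<lambda>n. measure (\<mu> n) {x. fst x \<le> K} \<le> 1 - \<epsilon>) sequentially"
  shows "\<exists>K. \<not> (\<lambda>n. measure (\<mu> n) {x. fst x \<le> K}) \<longlonglongrightarrow> measure (measure_pmf \<nu>) {x. fst x \<le> K}"
proof -
  obtain K where K: "measure \<nu> {x. fst x \<le> K} > 1 - \<epsilon>"
    using pmf_mass_fst_le[OF assms(1)] by blast
  have "measure \<nu> {x. fst x \<le> K} \<le> 1 - \<epsilon>"
    if "(\<lambda>n. measure (\<mu> n) {x. fst x \<le> K}) \<longlonglongrightarrow> measure \<nu> {x. fst x \<le> K}"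
    using that escape[of K] by (intro tendsto_upperbound) auto
  then show ?thesis
    using K by (intro exI[of _ K]) auto
qed

section \<open>Total variation and weak convergence as convergence of masses\<close>

lemma
  fixes p :: "('a::countable \<times> 'b::countable) pmf"
  shows prob_space_gibbs_law: "prob_space (gibbs_law p R x0 n)"
    and sets_gibbs_law: "sets (gibbs_law p R x0 n) = UNIV"
proof -
  interpret prob_space "gibbs_chain p R x0"
    by (rule prob_space_gibbs_chain)
  show "prob_space (gibbs_law p R x0 n)"
    unfolding gibbs_law_def by (rule prob_space_distr) simp
  show "sets (gibbs_law p R x0 n) = UNIV"
    by (simp add: gibbs_law_def)
qed

lemma tv_dist_imp_tendsto_measure:
  fixes p :: "('a::countable \<times> 'b::countable) pmf"
  assumes "(\<lambda>n. tv_dist (gibbs_law p R x0 n) (measure_pmf q)) \<longlonglongrightarrow> 0"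
  shows "(\<lambda>n. measure (gibbs_law p R x0 n) A) \<longlonglongrightarrow> measure (measure_pmf q) A"
proof -
  have "\<bar>measure (gibbs_law p R x0 n) A - measure q A\<bar> \<le> tv_dist (gibbs_law p R x0 n) (measure_pmf q)" for n
  proof -
    interpret L: prob_space "gibbs_law p R x0 n"
      by (rule prob_space_gibbs_law)
    \<comment> \<open>A real \<open>SUP\<close> dominates its members once the family is bounded
      above; the bound 1 provides this.\<close>
    have "\<bar>measure (gibbs_law p R x0 n) B - measure q B\<bar> \<le> 1" for B
      using L.prob_le_1[of B] measure_pmf.prob_le_1[of q B] measure_nonneg[of "gibbs_law p R x0 n" B]
        measure_nonneg[of q B] by linarith
    then have "bdd_above ((\<lambda>B. \<bar>measure (gibbs_law p R x0 n) B - measure q B\<bar>) ` sets (gibbs_law p R x0 n))"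
      by (intro bdd_aboveI2)
    then show ?thesis
      unfolding tv_dist_def by (rule cSUP_upper[rotated]) (simp add: sets_gibbs_law)
  qed
  then have "(\<lambda>n. measure (gibbs_law p R x0 n) A - measure q A) \<longlonglongrightarrow> 0"
    using assms by (intro Lim_null_comparison[OF _ assms]) auto
  then show ?thesis
    by (rule LIM_zero_cancel)
qed

text \<open>The natural numbers are discrete, so the indicator of a set described by the first
  coordinate is a continuous bounded test function.\<close>

lemma converges_in_distribution_imp_tendsto_measure:
  fixes p :: "(nat \<times> 'b::{countable, topological_space}) pmf"
  assumes "converges_in_distribution (gibbs_law p R x0) (measure_pmf \<nu>)"
  shows "(\<lambda>n. measure (gibbs_law p R x0 n) {x. fst x \<le> K}) \<longlonglongrightarrow> measure (measure_pmf \<nu>) {x. fst x \<le> K}"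
proof -
  let ?f = "indicator {x. fst x \<le> K} :: nat \<times> 'b \<Rightarrow> real"
  have "?f = (\<lambda>x. indicator {..K} (fst x))"
    by (auto simp: fun_eq_iff indicator_def)
  then have "continuous_on UNIV ?f"
    using continuous_on_compose2[of UNIV "indicator {..K} :: nat \<Rightarrow> real" UNIV fst]
    by (simp add: continuous_on_fst)
  moreover have "bounded (range ?f)"
    by (rule boundedI[of _ 1]) (auto simp: indicator_def)
  ultimately have "(\<lambda>n. \<integral>x. ?f x \<partial>gibbs_law p R x0 n) \<longlonglongrightarrow> (\<integral>x. ?f x \<partial>measure_pmf \<nu>)"
    using assms unfolding converges_in_distribution_def by blast
  moreover have "space (gibbs_law p R x0 n) = UNIV" for n
    by (simp add: gibbs_law_def)
  ultimately show ?thesis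
    by simp
qed

theorem proposition3p2:
  shows "\<exists>a :: nat \<Rightarrow> real.
    (\<forall>n. 8 < a n) \<and> incseq a \<and> filterlim a at_top sequentially \<and>
    \<not> ergodic target (diagonal_rule a) \<and>
    \<P>(\<omega> in gibbs_chain target (diagonal_rule a) (1, 1).
        filterlim (\<lambda>n. fst (\<omega> n)) at_top sequentially) > 0 \<and>
    \<not> (\<exists>\<nu> :: (nat \<times> nat) pmf. set_pmf \<nu> \<subseteq> state_space \<and>
        converges_in_distribution (gibbs_law target (diagonal_rule a) (1, 1)) (measure_pmf \<nu>)) \<and>
    \<not> (\<lambda>n. tv_dist (gibbs_law target (diagonal_rule a) (1, 1) n) (measure_pmf target)) \<longlonglongrightarrow> 0"
proof -
  \<comment> \<open>The constant 9 keeps the value above 8 at \<open>n = 0\<close>, where the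
    logarithm is 0. Logarithmic growth lets \<open>k / (a k)^2\<close> outgrow every multiple of
    \<open>ln k\<close>, which yields summability.\<close>
  define a :: "nat \<Rightarrow> real" where "a n = 9 + ln (real n + 1)" for n
  let ?M = "gibbs_chain target (diagonal_rule a) (1, 1)"
  let ?L = "gibbs_law target (diagonal_rule a) (1, 1)"
  have gt: "8 < a n" for n
    by (simp add: a_def add_pos_nonneg)
  have mono: "incseq a"
    by (auto simp: incseq_def a_def)
  have slow: "a (Suc n) / 2 \<le> a n - 1" for n
  proof -
    \<comment> \<open>As \<open>n + 2\<close> is at most \<open>2 * (n + 1)\<close>, one step raises
      \<open>a\<close> by at most \<open>ln 2 < 1\<close>, well within what values above 8
      allow.\<close>
    have "ln (real (Suc n) + 1) \<le> ln (2 * (real n + 1))"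
      by simp
    also have "\<dots> = ln 2 + ln (real n + 1)"
      by (rule ln_mult_pos) auto
    finally show ?thesis
      using ln_2_less_1 by (simp add: a_def) (smt (verit) ln_ge_zero of_nat_0_le_iff)
  qed
  have lim: "filterlim a at_top sequentially"
    unfolding a_def by real_asymp
  have "(\<lambda>k. exp (1 - real k / (a k)\<^sup>2)) \<in> O(\<lambda>k. 1 / real k ^ 2)"
    unfolding a_def by real_asymp
  moreover have "summable (\<lambda>k. norm (1 / real k ^ 2))"
    using inverse_power_summable[of 2, where 'a=real] by (simp add: field_simps)
  ultimately have "summable (\<lambda>k. exp (1 - real k / (a k)\<^sup>2))"
    by (metis summable_comparison_test_bigo)
  moreover have "slow_bias a"
    by unfold_locales (fact gt mono slow)+
  ultimately obtain N where N: "measure ?M {\<omega>. \<forall>m\<ge>N. a m \<le> height (\<omega> m)} > 0"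
    using slow_bias.prob_stays_above_pos by blast
  \<comment> \<open>Taking \<open>\<nu> = target\<close> refutes convergence in total variation;
    general \<open>\<nu>\<close> refutes convergence in distribution.\<close>
  have no_limit: "\<exists>K. \<not> (\<lambda>n. measure (?L n) {x. fst x \<le> K}) \<longlonglongrightarrow> measure (measure_pmf \<nu>) {x. fst x \<le> K}"
    for \<nu> :: "(nat \<times> nat) pmf"
    using N measure_gibbs_law_escape[OF order_refl one_in_target lim] by (rule not_convergent_if_escape)
  then have tv: "\<not> (\<lambda>n. tv_dist (?L n) (measure_pmf target)) \<longlonglongrightarrow> 0"
    using tv_dist_imp_tendsto_measure by blast
  \<comment> \<open>\<open>(1, 1)\<close> has positive target mass, so an almost-everywhere claim
    must hold there.\<close>
  then have "\<not> ergodic target (diagonal_rule a)"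
    using one_in_target by (auto simp: ergodic_def AE_measure_pmf_iff)
  moreover have "\<P>(\<omega> in ?M. filterlim (\<lambda>n. fst (\<omega> n)) at_top sequentially) > 0"
  proof -
    interpret prob_space ?M
      by (rule prob_space_gibbs_chain)
    have "measure ?M {\<omega>. \<forall>m\<ge>N. a m \<le> height (\<omega> m)} \<le>
        measure ?M {\<omega> \<in> space ?M. filterlim (\<lambda>n. fst (\<omega> n)) at_top sequentially}"
    proof (rule finite_measure_mono_AE)
      show "AE \<omega> in ?M. \<omega> \<in> {\<omega>. \<forall>m\<ge>N. a m \<le> height (\<omega> m)} \<longrightarrow>
          \<omega> \<in> {\<omega> \<in> space ?M. filterlim (\<lambda>n. fst (\<omega> n)) at_top sequentially}"
        using AE_gibbs_chain_in_support[OF one_in_target, of "diagonal_rule a"]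
      proof eventually_elim
        case (elim \<omega>)
        \<comment> \<open>On the ladder the first coordinate is the larger one, hence at least half
          the height.\<close>
        have "a m / 2 \<le> real (fst (\<omega> m))" if "\<forall>m\<ge>N. a m \<le> height (\<omega> m)" "m \<ge> N" for m
          using that elim[rule_format, of m]
          by (cases "\<omega> m") (force simp: set_pmf_target state_space_def height_def)
        moreover have "filterlim (\<lambda>m. a m / 2) at_top sequentially"
          unfolding a_def by real_asymp
        ultimately have "filterlim (\<lambda>n. real (fst (\<omega> n))) at_top sequentially"
          if "\<forall>m\<ge>N. a m \<le> height (\<omega> m)"
          using that by (metis (mono_tags, lifting) eventually_sequentiallyI filterlim_at_top_mono)
        then show ?case
          by (auto simp: space_gibbs_chain filterlim_sequentially_iff_filterlim_real)
      qed
      show "{\<omega> \<in> space ?M. filterlim (\<lambda>n. fst (\<omega> n)) at_top sequentially} \<in> sets ?M"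
        unfolding filterlim_at_top eventually_sequentially by measurable
    qed
    then show ?thesis
      using N by linarith
  qed
  moreover have "\<not> (\<exists>\<nu> :: (nat \<times> nat) pmf. set_pmf \<nu> \<subseteq> state_space \<and>
        converges_in_distribution ?L (measure_pmf \<nu>))"
    using no_limit converges_in_distribution_imp_tendsto_measure by blast
  ultimately show ?thesis
    using gt mono lim tv by blast
qed

end
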